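(* Let $n$ be a positive integer and let $A,B\in\mathbb{R}^{n\times n}$ be symmetric matrices. Then $$PB(A,B)\;\le\; QPB(A,B)\;\le\; SDPQAP(A,B)\;\le\; QAP(A,B),$$ where $PB$, $QPB$, $SDPQAP$ and $QAP$ are, respectively, the projected eigenvalue bound, the convex quadratic programming bound, the semidefinite programming bound and the optimal value of the quadratic assignment problem (all defined in the context).
   Context: Notation: $e$ is the all-ones vector; $I_k$, $J_k$ are the $k\times k$ identity and all-ones matrices; $E_{ij}$ is the matrix with a single one at position $(i,j)$; $\langle X,Y\rangle=\mathrm{tr}(X^TY)$; $\otimes$ is the Kronecker product; $\mathrm{vec}$ stacks the columns of a matrix; $S_n$ is the set of permutations of $\{1,\dots,n\}$; $X\succcurlyeq 0$ means $X$ is symmetric positive semidefinite; $X\ge 0$ for a matrix means entrywise nonnegative. For vectors $x,y$ of the same length $k$, $\langle x,y\rangle^-=\min_{\varphi\in S_k}\sum_{i=1}^k x_{\varphi(i)}y_i$. Quadratic assignment problem: $QAP(A,B)=\min_{\varphi\in S_n}\sum_{i,j=1}^n a_{ij}b_{\varphi(i)\varphi(j)}$. Let $V$ be an $n\times(n-1)$ matrix whose columns form an orthonormal basis of the orthogonal complement of $e$. Put $\tilde A=V^TAV$, $\tilde B=V^TBV$, and let $\lambda_{\tilde A}$, $\mu_{\tilde B}$ be the vectors of eigenvalues of $\tilde A$, $\tilde B$. Projected eigenvalue bound: with $D=(d_{ij})=\frac{2}{n}Aee^TB$, $$PB(A,B)=\langle\lambda_{\tilde A},\mu_{\tilde B}\rangle^-+\min_{\varphi\in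 S_n}\sum_{i=1}^n d_{i\varphi(i)}-\frac{(e^TAe)(e^TBe)}{n^2}.$$ Convex quadratic programming bound: let $(S^*,T^* )$ be any optimal solution of $\max\{\mathrm{tr}(S+T): \tilde B\otimes\tilde A-I_{n-1}\otimes S-T\otimes I_{n-1}\succcurlyeq 0\}$ over symmetric $(n-1)\times(n-1)$ matrices $S,T$ (it is known that the optimal value is $\mathrm{tr}(S^*+T^* )=\langle\lambda_{\tilde A},\mu_{\tilde B}\rangle^-$), and put $\hat Q=\tilde B\otimes\tilde A-I_{n-1}\otimes S^*-T^*\otimes I_{n-1}\succcurlyeq 0$. Then $$QPB(A,B)=\min\; y^T\hat Qy+\langle\lambda_{\tilde A},\mu_{\tilde B}\rangle^-+\frac2n\mathrm{tr}(BJ_nAX)-\frac{(e^TAe)(e^TBe)}{n^2},$$ where the minimum is over all doubly stochastic $X\ge0$, with $Y$ determined by $X=\frac1n ee^T+VYV^T$ (i.e. $Y=V^TXV$) and $y=\mathrm{vec}(Y)$. Semidefinite programming bound: $SDPQAP(A,B)$ is the minimum of $\langle B\otimes A,Y\rangle$ over all $Y\in\mathbb{R}^{n^2\times n^2}$ that are symmetric positive semidefinite and entrywise nonnegative and satisfy $\langle I_n\otimes E_{jj},Y\rangle=1$ and $\langle E_{jj}\otimes I_n,Y\rangle=1$ for $j=1,\dots,n$, $\langle I_n\otimes(J_n-I_n)+(J_n-I_n)\otimes I_n,Y\rangle=0$, and $\langle J_{n^2},Y\rangle=n^2$. *)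

theory Defs
  imports
    Complex_Main
    "HOL-Combinatorics.Permutations"
    "Jordan_Normal_Form.Char_Poly"
    "Jordan_Normal_Form.VS_Connect"
begin

text \<open>
  All indices are 0-based: positions run over \<open>{..<n}\<close> and \<open>S\<^sub>n\<close> is the set of
  \<open>\<phi>\<close> with \<open>\<phi> permutes {..<n}\<close>.

  Minima over infinite feasible sets are rendered by \<open>LEAST\<close>: it denotes the
  attained minimum, and has no specified value unless the minimum is attained.
\<close>

definition ones_vec :: "nat \<Rightarrow> real vec" where
  "ones_vec n = vec n (\<lambda>_. 1)"

definition ones_mat :: "nat \<Rightarrow> real mat" where
  "ones_mat n = mat n n (\<lambda>_. 1)"

definition unit_pos_mat :: "nat \<Rightarrow> nat \<Rightarrow> nat \<Rightarrow> real mat" where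
  "unit_pos_mat n i j = mat n n (\<lambda>p. if p = (i, j) then 1 else 0)"

definition mat_trace :: "real mat \<Rightarrow> real" where
  "mat_trace M = (\<Sum>i<dim_row M. M $$ (i, i))"

definition mat_inner :: "real mat \<Rightarrow> real mat \<Rightarrow> real" where
  "mat_inner X Y = mat_trace (X\<^sup>T * Y)"

definition kron :: "real mat \<Rightarrow> real mat \<Rightarrow> real mat" where
  "kron M N = mat (dim_row M * dim_row N) (dim_col M * dim_col N)
     (\<lambda>(i, j). M $$ (i div dim_row N, j div dim_col N) * N $$ (i mod dim_row N, j mod dim_col N))"

definition vec_of_mat :: "real mat \<Rightarrow> real vec" where
  "vec_of_mat M = vec (dim_row M * dim_col M) (\<lambda>k. M $$ (k mod dim_row M, k div dim_row M))"

definition symmetric_mat :: "real mat \<Rightarrow> bool" where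
  "symmetric_mat M \<longleftrightarrow> M\<^sup>T = M"

definition psd :: "real mat \<Rightarrow> bool" where
  "psd M \<longleftrightarrow> symmetric_mat M \<and> (\<forall>x \<in> carrier_vec (dim_row M). 0 \<le> x \<bullet> (M *\<^sub>v x))"

text \<open>
  The vector of eigenvalues, with algebraic multiplicities. It is only used for
  symmetric matrices, whose eigenvalues are all real, and only inside
  \<open>min_inner\<close>, which does not depend on the order of the entries.
\<close>

definition eigenvalues :: "real mat \<Rightarrow> real list" where
  "eigenvalues M = sorted_list_of_multiset (proots (char_poly M))"

definition min_inner :: "real list \<Rightarrow> real list \<Rightarrow> real" where
  "min_inner x y =
     Min ((\<lambda>\<phi>. \<Sum>i<length y. x ! \<phi> i * y ! i) ` {\<phi>. \<phi> permutes {..<length y}})"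

definition QAP :: "nat \<Rightarrow> real mat \<Rightarrow> real mat \<Rightarrow> real" where
  "QAP n A B =
     Min ((\<lambda>\<phi>. \<Sum>i<n. \<Sum>j<n. A $$ (i, j) * B $$ (\<phi> i, \<phi> j)) ` {\<phi>. \<phi> permutes {..<n}})"

definition onb_ones_complement :: "nat \<Rightarrow> real mat \<Rightarrow> bool" where
  "onb_ones_complement n V \<longleftrightarrow>
     V \<in> carrier_mat n (n - 1) \<and>
     (\<forall>i<n - 1. \<forall>j<n - 1. col V i \<bullet> col V j = (if i = j then 1 else 0)) \<and>
     vec_space.col_space n V = vec_module.orthogonal_complement n {ones_vec n}"

definition compress :: "real mat \<Rightarrow> real mat \<Rightarrow> real mat" where
  "compress V M = V\<^sup>T * M * V"

definition PB :: "nat \<Rightarrow> real mat \<Rightarrow> real mat \<Rightarrow> real mat \<Rightarrow> real" where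
  "PB n V A B =
     (let D = (2 / real n) \<cdot>\<^sub>m (A * ones_mat n * B) in
        min_inner (eigenvalues (compress V A)) (eigenvalues (compress V B))
        + Min ((\<lambda>\<phi>. \<Sum>i<n. D $$ (i, \<phi> i)) ` {\<phi>. \<phi> permutes {..<n}})
        - (ones_vec n \<bullet> (A *\<^sub>v ones_vec n)) * (ones_vec n \<bullet> (B *\<^sub>v ones_vec n)) / (real n)\<^sup>2)"

definition Q_hat :: "nat \<Rightarrow> real mat \<Rightarrow> real mat \<Rightarrow> real mat \<Rightarrow> real mat \<Rightarrow> real mat \<Rightarrow> real mat" where
  "Q_hat n V A B S T =
     kron (compress V B) (compress V A) - kron (1\<^sub>m (n - 1)) S - kron T (1\<^sub>m (n - 1))"

definition dual_feasible ::
    "nat \<Rightarrow> real mat \<Rightarrow> real mat \<Rightarrow> real mat \<Rightarrow> real mat \<times> real mat \<Rightarrow> bool" where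
  "dual_feasible n V A B = (\<lambda>(S, T).
     S \<in> carrier_mat (n - 1) (n - 1) \<and> symmetric_mat S \<and>
     T \<in> carrier_mat (n - 1) (n - 1) \<and> symmetric_mat T \<and>
     psd (Q_hat n V A B S T))"

definition dual_optimal ::
    "nat \<Rightarrow> real mat \<Rightarrow> real mat \<Rightarrow> real mat \<Rightarrow> real mat \<Rightarrow> real mat \<Rightarrow> bool" where
  "dual_optimal n V A B S T \<longleftrightarrow>
     is_arg_max (\<lambda>(S, T). mat_trace (S + T)) (dual_feasible n V A B) (S, T)"

definition doubly_stochastic :: "nat \<Rightarrow> real mat \<Rightarrow> bool" where
  "doubly_stochastic n X \<longleftrightarrow>
     X \<in> carrier_mat n n \<and> (\<forall>i<n. \<forall>j<n. 0 \<le> X $$ (i, j)) \<and>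
     (\<forall>i<n. (\<Sum>j<n. X $$ (i, j)) = 1) \<and> (\<forall>j<n. (\<Sum>i<n. X $$ (i, j)) = 1)"

definition QPB_objective ::
    "nat \<Rightarrow> real mat \<Rightarrow> real mat \<Rightarrow> real mat \<Rightarrow> real mat \<Rightarrow> real mat \<Rightarrow> real mat \<Rightarrow> real" where
  "QPB_objective n V A B S T X =
     (let y = vec_of_mat (V\<^sup>T * X * V) in
        y \<bullet> (Q_hat n V A B S T *\<^sub>v y)
        + min_inner (eigenvalues (compress V A)) (eigenvalues (compress V B))
        + 2 / real n * mat_trace (B * ones_mat n * A * X)
        - (ones_vec n \<bullet> (A *\<^sub>v ones_vec n)) * (ones_vec n \<bullet> (B *\<^sub>v ones_vec n)) / (real n)\<^sup>2)"

definition QPB ::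
    "nat \<Rightarrow> real mat \<Rightarrow> real mat \<Rightarrow> real mat \<Rightarrow> real mat \<Rightarrow> real mat \<Rightarrow> real" where
  "QPB n V A B S T = (LEAST v. \<exists>X. doubly_stochastic n X \<and> v = QPB_objective n V A B S T X)"

definition sdp_feasible :: "nat \<Rightarrow> real mat \<Rightarrow> bool" where
  "sdp_feasible n Y \<longleftrightarrow>
     Y \<in> carrier_mat (n\<^sup>2) (n\<^sup>2) \<and> psd Y \<and>
     (\<forall>i<n\<^sup>2. \<forall>j<n\<^sup>2. 0 \<le> Y $$ (i, j)) \<and>
     (\<forall>j<n. mat_inner (kron (1\<^sub>m n) (unit_pos_mat n j j)) Y = 1) \<and>
     (\<forall>j<n. mat_inner (kron (unit_pos_mat n j j) (1\<^sub>m n)) Y = 1) \<and>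
     mat_inner (kron (1\<^sub>m n) (ones_mat n - 1\<^sub>m n) + kron (ones_mat n - 1\<^sub>m n) (1\<^sub>m n)) Y = 0 \<and>
     mat_inner (ones_mat (n\<^sup>2)) Y = (real n)\<^sup>2"

definition SDPQAP :: "nat \<Rightarrow> real mat \<Rightarrow> real mat \<Rightarrow> real" where
  "SDPQAP n A B = (LEAST v. \<exists>Y. sdp_feasible n Y \<and> v = mat_inner (kron B A) Y)"

end

theory Submission
  imports
    Defs
    "Jordan_Normal_Form.Schur_Decomposition"
    "HOL-Analysis.Function_Topology"
begin

text \<open>
  Since \<open>Q_hat\<close> is positive semidefinite, a feasible \<open>X\<close> of the quadratic program has objective
  at least the projected eigenvalue bound, because a linear function on doubly stochastic
  matrices is bounded below by its values at permutations.

  For a feasible \<open>Y\<close> of the semidefinite program let \<open>x\<close> be its diagonal and \<open>X\<close> the matrix with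
  \<open>vec X = x\<close>. The indicator vectors \<open>u\<^sub>k\<close> of the blocks satisfy \<open>u\<^sub>k \<bullet> Y u\<^sub>k = 1\<close>, and the condition on
  the sum of all entries of \<open>Y\<close> forces \<open>Y u\<^sub>k = x\<close> for every \<open>k\<close>. Hence \<open>Y - x x\<^sup>T\<close> is positive
  semidefinite, all partial sums of \<open>Y\<close> over one index are known, and with
  \<open>P = V V\<^sup>T = I - J / n\<close> the inner products of \<open>Y\<close> with \<open>P B P \<otimes> P A P\<close>, \<open>P \<otimes> V S V\<^sup>T\<close> and
  \<open>V T V\<^sup>T \<otimes> P\<close> can be computed. Pairing \<open>Y - x x\<^sup>T\<close> with the lift of \<open>Q_hat\<close> bounds the quadratic
  objective at \<open>X\<close> by the semidefinite objective at \<open>Y\<close>, up to the difference of \<open>tr (S + T)\<close> and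
  the minimal scalar product of the eigenvalues; optimality of \<open>(S, T)\<close> controls its sign, as a dual
  point attaining the minimal scalar product is obtained from spectral decompositions and
  potentials of the assignment problem.

  A permutation gives a feasible rank one \<open>Y\<close> with the same objective value. The minima are
  attained by compactness, so the \<open>LEAST\<close> values are meaningful.
\<close>

subsection \<open>Traces and quadratic forms\<close>

lemma sum_lessThan_mult:
  "(\<Sum>k<m * n. f k) = (\<Sum>i<m. \<Sum>j<n. f (i * n + j))" for f :: "nat \<Rightarrow> 'a::comm_monoid_add"
proof -
  have "(\<Sum>k = i * n..<i * n + n. f k) = (\<Sum>j<n. f (i * n + j))" for i
    using sum.shift_bounds_nat_ivl[of f 0 "i * n" n]
    by (simp add: add.commute atLeast0LessThan)
  thus ?thesis by (simp add: sum.nat_group[symmetric])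
qed

lemma pair_index_less: "i < m \<Longrightarrow> j < n \<Longrightarrow> i * n + j < m * (n::nat)"
  proof -
  assume "i < m" "j < n"
  hence "i * n + j < Suc i * n" by simp
  also have "\<dots> \<le> m * n" using \<open>i < m\<close> by (intro mult_le_mono1) simp
  finally show ?thesis .
qed

lemma pair_index_cases:
  assumes "k < m * (n::nat)"
  obtains i j where "i < m" "j < n" "k = i * n + j"
proof
  have "n > 0" using assms by (cases n) auto
  thus "k div n < m" "k mod n < n" "k = k div n * n + k mod n"
    using assms by (auto simp: less_mult_imp_div_less)
qed

lemma scalar_prod_sum: "v \<bullet> w = (\<Sum>i<dim_vec w. v $ i * w $ i)"
  by (simp add: scalar_prod_def atLeast0LessThan)

lemma mult_mat_index:
  "A \<in> carrier_mat r m \<Longrightarrow> B \<in> carrier_mat m c \<Longrightarrow> i < r \<Longrightarrow> j < c \<Longrightarrow>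
   (A * B) $$ (i, j) = (\<Sum>k<m. A $$ (i, k) * B $$ (k, j))"
  by (simp add: scalar_prod_def atLeast0LessThan)

lemma mult_mat_vec_index:
  "A \<in> carrier_mat r m \<Longrightarrow> v \<in> carrier_vec m \<Longrightarrow> i < r \<Longrightarrow>
   (A *\<^sub>v v) $ i = (\<Sum>k<m. A $$ (i, k) * v $ k)"
  by (simp add: scalar_prod_def atLeast0LessThan)

lemma quadratic_form_sum:
  assumes "M \<in> carrier_mat n n" "x \<in> carrier_vec n" "y \<in> carrier_vec n"
  shows "x \<bullet> (M *\<^sub>v y) = (\<Sum>i<n. \<Sum>j<n. x $ i * M $$ (i, j) * y $ j)"
proof -
  have "x \<bullet> (M *\<^sub>v y) = (\<Sum>i<n. x $ i * (M *\<^sub>v y) $ i)"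
    using assms by (simp add: scalar_prod_sum)
  also have "\<dots> = (\<Sum>i<n. \<Sum>j<n. x $ i * M $$ (i, j) * y $ j)"
    by (intro sum.cong refl)
      (simp add: mult_mat_vec_index[OF assms(1,3)] sum_distrib_left mult.assoc)
  finally show ?thesis .
qed

lemma quadratic_form_transpose:
  fixes M :: "real mat"
  assumes "M \<in> carrier_mat m n" "x \<in> carrier_vec m" "y \<in> carrier_vec n"
  shows "x \<bullet> (M *\<^sub>v y) = (M\<^sup>T *\<^sub>v x) \<bullet> y"
  using assms by (simp add: transpose_vec_mult_scalar)

lemma mat_trace_comm:
  assumes "A \<in> carrier_mat m n" "B \<in> carrier_mat n m"
  shows "mat_trace (A * B) = mat_trace (B * A)"
proof -
  have "mat_trace (A * B) = (\<Sum>i<m. \<Sum>k<n. A $$ (i, k) * B $$ (k, i))"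
    using assms by (simp add: mat_trace_def mult_mat_index del: index_mult_mat(1))
  also have "\<dots> = (\<Sum>k<n. \<Sum>i<m. B $$ (k, i) * A $$ (i, k))"
    by (subst sum.swap) (simp add: mult.commute)
  also have "\<dots> = mat_trace (B * A)"
    using assms by (simp add: mat_trace_def mult_mat_index del: index_mult_mat(1))
  finally show ?thesis .
qed

lemma mat_trace_add:
  "A \<in> carrier_mat n n \<Longrightarrow> B \<in> carrier_mat n n \<Longrightarrow> mat_trace (A + B) = mat_trace A + mat_trace B"
  by (simp add: mat_trace_def sum.distrib)

lemma mat_inner_sum:
  assumes "X \<in> carrier_mat m n" "Y \<in> carrier_mat m n"
  shows "mat_inner X Y = (\<Sum>i<m. \<Sum>j<n. X $$ (i, j) * Y $$ (i, j))"
proof -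
  have "mat_inner X Y = (\<Sum>j<n. \<Sum>i<m. X $$ (i, j) * Y $$ (i, j))"
    using assms by (simp add: mat_inner_def mat_trace_def mult_mat_index[of "X\<^sup>T" n m Y n] del: index_mult_mat(1))
  thus ?thesis by (simp add: sum.swap[of _ "{..<m}"])
qed

lemma mat_inner_add_left:
  "A \<in> carrier_mat m n \<Longrightarrow> B \<in> carrier_mat m n \<Longrightarrow> Y \<in> carrier_mat m n \<Longrightarrow>
   mat_inner (A + B) Y = mat_inner A Y + mat_inner B Y"
  by (simp add: mat_inner_sum[of _ m n] algebra_simps sum.distrib)

lemma mat_inner_minus_left:
  "A \<in> carrier_mat m n \<Longrightarrow> B \<in> carrier_mat m n \<Longrightarrow> Y \<in> carrier_mat m n \<Longrightarrow>
   mat_inner (A - B) Y = mat_inner A Y - mat_inner B Y"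
  by (simp add: mat_inner_sum[of _ m n] algebra_simps sum_subtractf minus_carrier_mat)

lemma mat_inner_minus_right:
  "A \<in> carrier_mat m n \<Longrightarrow> B \<in> carrier_mat m n \<Longrightarrow> Y \<in> carrier_mat m n \<Longrightarrow>
   mat_inner Y (A - B) = mat_inner Y A - mat_inner Y B"
  by (simp add: mat_inner_sum[of _ m n] algebra_simps sum_subtractf minus_carrier_mat)

lemma transpose_congruence:
  fixes W X :: "real mat"
  assumes "W \<in> carrier_mat N M" "X \<in> carrier_mat M M"
  shows "(W * X * W\<^sup>T)\<^sup>T = W * X\<^sup>T * W\<^sup>T"
proof -
  have "(W * X * W\<^sup>T)\<^sup>T = W * (X\<^sup>T * W\<^sup>T)"
    using assms transpose_mult[of "W * X" N M "W\<^sup>T" N] transpose_mult[of W N M X M] by simp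
  also have "\<dots> = W * X\<^sup>T * W\<^sup>T"
    using assms by (intro assoc_mult_mat[symmetric]) auto
  finally show ?thesis .
qed

text \<open>Cyclicity of the trace makes congruence by \<open>W\<close> adjoint to congruence by
  \<open>W\<^sup>T\<close>, so an orthogonal diagonalisation of one factor can be transferred to the
  other.\<close>

lemma mat_inner_congruence:
  assumes W: "W \<in> carrier_mat N M" and X: "X \<in> carrier_mat M M" and Y: "Y \<in> carrier_mat N N"
  shows "mat_inner (W * X * W\<^sup>T) Y = mat_inner X (W\<^sup>T * Y * W)"
proof -
  have "(W * X * W\<^sup>T)\<^sup>T * Y = W * (X\<^sup>T * (W\<^sup>T * Y))"
    unfolding transpose_congruence[OF W X] using assms
      assoc_mult_mat[of "W * X\<^sup>T" N M "W\<^sup>T" N Y N] assoc_mult_mat[of W N M "X\<^sup>T" M "W\<^sup>T * Y" N]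
    by simp
  hence "mat_inner (W * X * W\<^sup>T) Y = mat_trace (W * (X\<^sup>T * (W\<^sup>T * Y)))"
    by (simp add: mat_inner_def)
  also have "\<dots> = mat_trace (X\<^sup>T * (W\<^sup>T * Y) * W)"
    by (rule mat_trace_comm) (use assms in auto)
  also have "X\<^sup>T * (W\<^sup>T * Y) * W = X\<^sup>T * (W\<^sup>T * Y * W)"
    using assms by (intro assoc_mult_mat) auto
  finally show ?thesis by (simp add: mat_inner_def)
qed

lemma symmetric_mat_congruence:
  assumes "W \<in> carrier_mat N M" "X \<in> carrier_mat M M" "symmetric_mat X"
  shows "symmetric_mat (W * X * W\<^sup>T)"
  using transpose_congruence[OF assms(1,2)] assms(3) by (simp add: symmetric_mat_def)

lemma symmetric_mat_index:
  "symmetric_mat M \<Longrightarrow> M \<in> carrier_mat n n \<Longrightarrow> i < n \<Longrightarrow> j < n \<Longrightarrow> M $$ (i, j) = M $$ (j, i)"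
  by (metis carrier_matD index_transpose_mat(1) symmetric_mat_def)

text \<open>The form of the congruent matrix at \<open>x\<close> is the form of \<open>X\<close> at
  \<open>W\<^sup>T *\<^sub>v x\<close>. Rectangular \<open>W\<close> are allowed, as the lift of
  \<open>Q_hat\<close> along \<open>kron V V\<close> requires.\<close>

lemma psd_congruence:
  assumes W: "W \<in> carrier_mat N M" and X: "X \<in> carrier_mat M M" and psd: "psd X"
  shows "psd (W * X * W\<^sup>T)"
  unfolding psd_def
proof (intro conjI ballI)
  show "symmetric_mat (W * X * W\<^sup>T)"
    using assms by (intro symmetric_mat_congruence) (auto simp: psd_def)
  fix x :: "real vec" assume "x \<in> carrier_vec (dim_row (W * X * W\<^sup>T))"
  hence x: "x \<in> carrier_vec N" using W by simp
  have "(W * X * W\<^sup>T) *\<^sub>v x = W *\<^sub>v (X *\<^sub>v (W\<^sup>T *\<^sub>v x))"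
    using W X x by (simp add: assoc_mult_mat_vec[of _ N M _ N] assoc_mult_mat_vec[of _ N M _ M])
  hence "x \<bullet> ((W * X * W\<^sup>T) *\<^sub>v x) = (W\<^sup>T *\<^sub>v x) \<bullet> (X *\<^sub>v (W\<^sup>T *\<^sub>v x))"
    using W X x by (simp add: quadratic_form_transpose[of W N M])
  thus "0 \<le> x \<bullet> ((W * X * W\<^sup>T) *\<^sub>v x)"
    using psd W X x by (simp add: psd_def)
qed

lemma psd_diag_nonneg:
  assumes "psd M" "M \<in> carrier_mat n n" "i < n"
  shows "0 \<le> M $$ (i, i)"
proof -
  have "unit_vec n i \<bullet> (M *\<^sub>v unit_vec n i) = M $$ (i, i)"
    using assms by (simp add: mult_mat_vec_index[of M n n] scalar_prod_left_unit[of _ n])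
  thus ?thesis using assms by (metis carrier_matD(1) psd_def unit_vec_carrier)
qed

lemma psd_mat_diag:
  assumes "\<And>i. i < n \<Longrightarrow> 0 \<le> d i"
  shows "psd (mat_diag n d)"
  unfolding psd_def
proof (intro conjI ballI)
  show "symmetric_mat (mat_diag n d)" by (auto simp: symmetric_mat_def mat_diag_def)
  fix x :: "real vec" assume "x \<in> carrier_vec (dim_row (mat_diag n d))"
  hence x: "x \<in> carrier_vec n" by (simp add: mat_diag_def)
  have "x \<bullet> (mat_diag n d *\<^sub>v x) = (\<Sum>i<n. \<Sum>j<n. if i = j then d i * (x $ i)\<^sup>2 else 0)"
    unfolding quadratic_form_sum[OF mat_diag_dim x x]
    by (intro sum.cong refl) (auto simp: mat_diag_def power2_eq_square)
  also have "\<dots> = (\<Sum>i<n. d i * (x $ i)\<^sup>2)" by simp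
  also have "\<dots> \<ge> 0" using assms by (intro sum_nonneg) auto
  finally show "0 \<le> x \<bullet> (mat_diag n d *\<^sub>v x)" .
qed

subsection \<open>The spectral theorem for real symmetric matrices\<close>

text \<open>Gram-Schmidt applied to a basis that begins with \<open>v\<close> leaves
  \<open>v\<close> in first place. Normalising the orthogonal vectors gives the columns of
  \<open>W\<close>, with \<open>c\<close> the reciprocal of the length of \<open>v\<close>.\<close>

lemma orthonormal_completion:
  fixes v :: "real vec"
  assumes v: "v \<in> carrier_vec n" and v0: "v \<noteq> 0\<^sub>v n"
  obtains W c where "W \<in> carrier_mat n n" "W\<^sup>T * W = 1\<^sub>m n" "W * W\<^sup>T = 1\<^sub>m n" "col W 0 = c \<cdot>\<^sub>v v"
proof -
  interpret cof_vec_space n "TYPE(real)" .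
  define b where "b = basis_completion v"
  define ws where "ws = gram_schmidt n b"
  note b = basis_completion[OF v v0, folded b_def]
  have n0: "n > 0" using v v0 by (cases n) auto
  note gs = gram_schmidt_result[OF b(2,4,5) refl, folded ws_def]
  have len: "length ws = n" using gs(4) b(6) by simp
  have car: "ws ! i \<in> carrier_vec n" if "i < n" for i using gs(3) len that by auto
  from b(6,7) n0 obtain vs where "b = v # vs" by (cases b) auto
  hence "hd ws = v" unfolding ws_def using gram_schmidt_hd[OF v] by simp
  hence w0: "ws ! 0 = v" using len n0 by (metis hd_conv_nth length_greater_0_conv)
  define r where "r i = sqrt (ws ! i \<bullet> ws ! i)" for i
  define W where "W = mat n n (\<lambda>(i, j). ws ! j $ i / r j)"
  have W: "W \<in> carrier_mat n n" by (simp add: W_def)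
  have r: "r i * r i = ws ! i \<bullet> ws ! i" "r i \<noteq> 0" if "i < n" for i
  proof -
    have "0 \<le> ws ! i \<bullet> ws ! i" by (simp add: scalar_prod_sum sum_nonneg)
    moreover have "ws ! i \<bullet> ws ! i \<noteq> 0" using corthogonalD[OF gs(2), of i i] that len by simp
    ultimately show "r i * r i = ws ! i \<bullet> ws ! i" "r i \<noteq> 0" by (simp_all add: r_def)
  qed
  have "W\<^sup>T * W = 1\<^sub>m n"
  proof (rule eq_matI)
    fix i j assume "i < dim_row (1\<^sub>m n :: real mat)" "j < dim_col (1\<^sub>m n :: real mat)"
    hence ij: "i < n" "j < n" by auto
    have "(W\<^sup>T * W) $$ (i, j) = (\<Sum>k<n. ws ! i $ k * ws ! j $ k / (r i * r j))"
      using ij W by (subst mult_mat_index[of _ n n _ n]) (auto simp: W_def)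
    also have "\<dots> = (ws ! i \<bullet> ws ! j) / (r i * r j)"
      using car[OF ij(2)] by (simp add: scalar_prod_sum sum_divide_distrib)
    also have "\<dots> = 1\<^sub>m n $$ (i, j)"
      using corthogonalD[OF gs(2), of i j] ij len r[of i] by auto
    finally show "(W\<^sup>T * W) $$ (i, j) = 1\<^sub>m n $$ (i, j)" .
  qed (simp_all add: W_def)
  moreover from this have "W * W\<^sup>T = 1\<^sub>m n" using W mat_mult_left_right_inverse[of "W\<^sup>T" n W] by simp
  moreover have "col W 0 = (1 / r 0) \<cdot>\<^sub>v v"
    using n0 v w0 by (intro eq_vecI) (auto simp: W_def)
  ultimately show thesis using that W by blast
qed

lemma char_poly_one_by_one:
  "char_poly (mat 1 1 (\<lambda>_. e) :: real mat) = [:-e, 1:]"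
  by (simp add: char_poly_defs det_def sign_def)

text \<open>Deflation: an eigenvector for the first root becomes the first column of an orthogonal
  matrix, and symmetry splits off a one by one block. The list of roots is an input, so that the
  order of the diagonal entries can be prescribed; increasing and decreasing orders both occur
  later.\<close>

lemma real_spectral_theorem:
  fixes M :: "real mat"
  assumes "M \<in> carrier_mat n n" "symmetric_mat M" "char_poly M = (\<Prod>e\<leftarrow>es. [:-e, 1:])"
  shows "\<exists>U. U \<in> carrier_mat n n \<and> U\<^sup>T * U = 1\<^sub>m n \<and> M = U * mat_diag n (\<lambda>i. es ! i) * U\<^sup>T"
  using assms
proof (induction es arbitrary: n M)
  case Nil
  with degree_monic_char_poly[of M n] have "n = 0" by auto
  with Nil show ?case by (intro exI[of _ "1\<^sub>m 0"]) (auto intro!: eq_matI)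
next
  case (Cons e es n M)
  have M: "M \<in> carrier_mat n n" by fact
  have "length (e # es) = n"
    using degree_monic_char_poly[OF M] Cons.prems(3) degree_linear_factors[of uminus "e # es"] by simp
  then obtain m where n: "n = Suc m" by auto
  have "eigenvalue M e" unfolding eigenvalue_root_char_poly[OF M] Cons.prems(3) by simp
  then obtain v where v: "v \<in> carrier_vec n" "v \<noteq> 0\<^sub>v n" "M *\<^sub>v v = e \<cdot>\<^sub>v v"
    using M by (auto simp: eigenvalue_def eigenvector_def)
  obtain W c where W: "W \<in> carrier_mat n n" "W\<^sup>T * W = 1\<^sub>m n" "W * W\<^sup>T = 1\<^sub>m n" "col W 0 = c \<cdot>\<^sub>v v"
    by (rule orthonormal_completion[OF v(1,2)])
  define M' where "M' = W\<^sup>T * M * W"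
  have M': "M' \<in> carrier_mat n n" using M W by (simp add: M'_def)
  have sym': "symmetric_mat M'"
    using symmetric_mat_congruence[of "W\<^sup>T" n n M] M W Cons.prems(2) by (simp add: M'_def)
  \<comment> \<open>The first column of \<open>M'\<close> is \<open>e\<close> times the first unit
    vector. By symmetry this also settles the first row, which gives the block form below.\<close>
  have col0: "M' $$ (i, 0) = (if i = 0 then e else 0)" if "i < n" for i
  proof -
    have "col M' 0 = W\<^sup>T * M *\<^sub>v col W 0"
      unfolding M'_def by (rule col_mult2[of _ n n _ n]) (use M W n in auto)
    also have "\<dots> = W\<^sup>T *\<^sub>v (M *\<^sub>v col W 0)"
      using M W v n by (intro assoc_mult_mat_vec[of _ n n]) auto
    also have "M *\<^sub>v col W 0 = e \<cdot>\<^sub>v col W 0"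
      unfolding W(4) using M v by (simp add: mult_mat_vec[of _ n n] smult_smult_assoc mult.commute)
    also have "W\<^sup>T *\<^sub>v (e \<cdot>\<^sub>v col W 0) = e \<cdot>\<^sub>v (W\<^sup>T *\<^sub>v col W 0)"
      using W v n by (intro mult_mat_vec[of _ n n]) auto
    also have "W\<^sup>T *\<^sub>v col W 0 = col (W\<^sup>T * W) 0"
      by (rule col_mult2[symmetric, of _ n n _ n]) (use W n in auto)
    finally have "col M' 0 $ i = (e \<cdot>\<^sub>v col (1\<^sub>m n) 0) $ i" by (simp add: W(2))
    thus ?thesis using that n M' by auto
  qed
  define M2 where "M2 = mat m m (\<lambda>(i, j). M' $$ (Suc i, Suc j))"
  have M2: "M2 \<in> carrier_mat m m" by (simp add: M2_def)
  let ?E = "mat 1 1 (\<lambda>_. e) :: real mat"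
  have block: "M' = four_block_mat ?E (0\<^sub>m 1 m) (0\<^sub>m m 1) M2"
  proof (rule eq_matI)
    fix i j assume "i < dim_row (four_block_mat ?E (0\<^sub>m 1 m) (0\<^sub>m m 1) M2)"
      "j < dim_col (four_block_mat ?E (0\<^sub>m 1 m) (0\<^sub>m m 1) M2)"
    hence ij: "i < n" "j < n" using M2 n by auto
    have "M' $$ (0, j) = M' $$ (j, 0)" using symmetric_mat_index[OF sym' M'] ij n by simp
    thus "M' $$ (i, j) = four_block_mat ?E (0\<^sub>m 1 m) (0\<^sub>m m 1) M2 $$ (i, j)"
      using ij n col0 M2 by (cases i; cases j) (auto simp: M2_def)
  qed (use M' M2 n in auto)
  have "similar_mat M' M" unfolding similar_mat_def M'_def
    by (intro exI[of _ "W\<^sup>T"] exI[of _ W], rule similar_mat_witI[of _ _ n]) (use W M in auto)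
  hence "char_poly M = char_poly M'" by (simp add: char_poly_similar)
  also have "\<dots> = [:-e, 1:] * char_poly M2"
    unfolding block by (subst char_poly_four_block_zeros_col) (use M2 char_poly_one_by_one in auto)
  finally have "char_poly M2 = (\<Prod>e\<leftarrow>es. [:-e, 1:])"
    using Cons.prems(3) by (simp add: mult_cancel_left del: mult_pCons_left)
  moreover have "symmetric_mat M2"
    unfolding symmetric_mat_def using n symmetric_mat_index[OF sym' M']
    by (intro eq_matI) (auto simp: M2_def)
  ultimately obtain U where U: "U \<in> carrier_mat m m" "U\<^sup>T * U = 1\<^sub>m m"
      "M2 = U * mat_diag m (\<lambda>i. es ! i) * U\<^sup>T"
    using Cons.IH[OF M2] by blast
  \<comment> \<open>\<open>F\<close> fixes the first coordinate and acts as \<open>U\<close> on the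
    others; the matrix that diagonalises \<open>M\<close> will be \<open>W * F\<close>.\<close>
  define F where "F = four_block_mat (1\<^sub>m 1) (0\<^sub>m 1 m) (0\<^sub>m m 1) U"
  have FT: "F\<^sup>T = four_block_mat (1\<^sub>m 1) (0\<^sub>m 1 m) (0\<^sub>m m 1) U\<^sup>T"
    unfolding F_def using U by (subst transpose_four_block_mat[of _ 1 1 _ m _ m]) auto
  have F: "F \<in> carrier_mat n n"
    using four_block_carrier_mat[OF one_carrier_mat U(1), of 1] n by (simp add: F_def)
  have FF: "F\<^sup>T * F = 1\<^sub>m n"
    unfolding FT unfolding F_def using U n
    by (subst mult_four_block_mat[of _ 1 1 _ m _ m _ _ 1 _ m]) auto
  have D: "mat_diag n (\<lambda>i. (e # es) ! i) = four_block_mat ?E (0\<^sub>m 1 m) (0\<^sub>m m 1) (mat_diag m (\<lambda>i. es ! i))"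
    using n by (intro eq_matI) (auto simp: mat_diag_def nth_Cons split: nat.splits)
  have "F * mat_diag n (\<lambda>i. (e # es) ! i) = four_block_mat ?E (0\<^sub>m 1 m) (0\<^sub>m m 1) (U * mat_diag m (\<lambda>i. es ! i))"
    unfolding F_def D using U n
    by (subst mult_four_block_mat[of _ 1 1 _ m _ m _ _ 1 _ m]) (auto simp: mat_diag_def)
  hence M'F: "M' = F * mat_diag n (\<lambda>i. (e # es) ! i) * F\<^sup>T"
    unfolding block FT using U n
    by simp (subst mult_four_block_mat[of _ 1 1 _ m _ m _ _ 1 _ m]; auto simp: mat_diag_def)
  define D where "D = mat_diag n (\<lambda>i. (e # es) ! i)"
  have Dc: "D \<in> carrier_mat n n" by (simp add: D_def)
  note car = M W(1) F Dc transpose_carrier_mat[of _ n n]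
  have "M = (W * W\<^sup>T) * M * (W * W\<^sup>T)" using M W by simp
  also have "\<dots> = W * M' * W\<^sup>T"
    unfolding M'_def using car by (simp add: assoc_mult_mat[of _ n n _ n _ n])
  also have "\<dots> = (W * F) * D * (W * F)\<^sup>T"
    unfolding M'F D_def[symmetric] using car
    by (simp add: transpose_mult[of _ n n] assoc_mult_mat[of _ n n _ n _ n])
  finally have "M = (W * F) * D * (W * F)\<^sup>T" .
  moreover have "(W * F)\<^sup>T * (W * F) = F\<^sup>T * ((W\<^sup>T * W) * F)"
    using car by (simp add: transpose_mult[of _ n n] assoc_mult_mat[of _ n n _ n _ n] del: W(2))
  hence "(W * F)\<^sup>T * (W * F) = 1\<^sub>m n" using F FF W by simp
  ultimately show ?case unfolding D_def using W F by (intro exI[of _ "W * F"]) auto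
qed

text \<open>The Hermitian form \<open>q\<close> of \<open>M\<close> at an eigenvector is computed in
  two ways: it is \<open>a\<close> times the positive number \<open>s\<close>, and it equals its own
  conjugate because \<open>M\<close> is real and symmetric.\<close>

lemma symmetric_eigenvalue_real:
  fixes M :: "real mat"
  assumes M: "M \<in> carrier_mat n n" and sym: "symmetric_mat M"
    and ev: "eigenvalue (map_mat complex_of_real M) a"
  shows "Im a = 0"
proof -
  let ?M = "map_mat complex_of_real M"
  obtain v where v: "v \<in> carrier_vec n" "v \<noteq> 0\<^sub>v n" "?M *\<^sub>v v = a \<cdot>\<^sub>v v"
    using ev M by (auto simp: eigenvalue_def eigenvector_def)
  define q where "q = (\<Sum>i<n. \<Sum>j<n. cnj (v $ i) * complex_of_real (M $$ (i, j)) * v $ j)"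
  define s where "s = (\<Sum>i<n. (cmod (v $ i))\<^sup>2)"
  have Mv: "(\<Sum>j<n. complex_of_real (M $$ (i, j)) * v $ j) = a * v $ i" if "i < n" for i
    using arg_cong[OF v(3), of "\<lambda>w. w $ i"] M v(1) that
    by (simp add: mult_mat_vec_index[of ?M n n] del: index_mult_mat_vec)
  have "q = (\<Sum>i<n. cnj (v $ i) * (a * v $ i))"
    unfolding q_def mult.assoc sum_distrib_left[symmetric] by (simp add: Mv)
  also have "\<dots> = a * (\<Sum>i<n. v $ i * cnj (v $ i))" by (simp add: sum_distrib_left ac_simps)
  also have "\<dots> = a * of_real s"
    by (simp add: s_def complex_norm_square del: of_real_power)
  finally have q: "q = a * of_real s" .
  have "cnj q = (\<Sum>i<n. \<Sum>j<n. v $ i * complex_of_real (M $$ (i, j)) * cnj (v $ j))"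
    by (simp add: q_def)
  also have "\<dots> = (\<Sum>j<n. \<Sum>i<n. v $ i * complex_of_real (M $$ (i, j)) * cnj (v $ j))"
    by (rule sum.swap)
  also have "\<dots> = q"
    unfolding q_def using symmetric_mat_index[OF sym M] by (intro sum.cong refl) (simp add: ac_simps)
  finally have "Im (a * of_real s) = 0" unfolding q by (metis Reals_cnj_iff complex_is_Real_iff)
  moreover have "s \<noteq> 0"
  proof -
    obtain i where "i < n" "v $ i \<noteq> 0" using v(1,2) by (metis eq_vecI carrier_vecD index_zero_vec)
    hence "0 < s" unfolding s_def by (intro sum_pos2[of _ i]) auto
    thus ?thesis by simp
  qed
  ultimately show ?thesis by simp
qed

text \<open>The characteristic polynomial splits over the complex numbers and all its roots are
  real, so the factorisation can be pulled back along the injective embedding of real into complex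
  polynomials.\<close>

lemma symmetric_char_poly_splits:
  fixes M :: "real mat"
  assumes M: "M \<in> carrier_mat n n" and sym: "symmetric_mat M"
  shows "\<exists>es. char_poly M = (\<Prod>e\<leftarrow>es. [:-e, 1:]) \<and> length es = n"
proof -
  let ?M = "map_mat complex_of_real M"
  have Mc: "?M \<in> carrier_mat n n" using M by simp
  obtain as where as: "char_poly ?M = (\<Prod>a\<leftarrow>as. [:-a, 1:])" "length as = n"
    using char_poly_factorized[OF Mc] by blast
  have real: "a = complex_of_real (Re a)" if "a \<in> set as" for a
  proof -
    have "poly (char_poly ?M) a = 0" unfolding as(1) using that by (auto simp: poly_prod_list prod_list_zero_iff)
    hence "Im a = 0" using symmetric_eigenvalue_real[OF M sym] by (simp add: eigenvalue_root_char_poly[OF Mc])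
    thus ?thesis by (simp add: complex_eq_iff)
  qed
  interpret of_real_poly_hom: map_poly_inj_idom_hom complex_of_real ..
  have "map_poly complex_of_real (char_poly M) = char_poly ?M"
    using M by (simp add: of_real_hom.char_poly_hom)
  also have "\<dots> = (\<Prod>a\<leftarrow>as. map_poly complex_of_real [:-Re a, 1:])"
    unfolding as(1) using real by (intro arg_cong[of _ _ prod_list] map_cong) (auto simp: hom_distribs)
  also have "\<dots> = map_poly complex_of_real (\<Prod>e\<leftarrow>map Re as. [:-e, 1:])"
    by (simp add: of_real_poly_hom.hom_prod_list o_def)
  finally have "char_poly M = (\<Prod>e\<leftarrow>map Re as. [:-e, 1:])" by simp
  thus ?thesis using as(2) by (metis length_map)
qed

lemma proots_linear_factors: "proots (\<Prod>e\<leftarrow>es. [:-e, 1:]) = mset (es::real list)"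
proof (induction es)
  case (Cons a es)
  have "(\<Prod>e\<leftarrow>es. [:-e, 1:]) \<noteq> 0" by (simp add: prod_list_zero_iff image_iff)
  thus ?case using Cons proots_mult[of "[:-a, 1:]" "\<Prod>e\<leftarrow>es. [:-e, 1:]"]
    by (simp del: mult_pCons_left)
qed simp

text \<open>By symmetry no root is lost when only real roots are collected. Hence
  \<open>eigenvalues M\<close> has full length and can serve as the prescribed list in
  \<open>real_spectral_theorem\<close>.\<close>

lemma char_poly_eigenvalues:
  assumes "M \<in> carrier_mat n n" "symmetric_mat M"
  shows "char_poly M = (\<Prod>e\<leftarrow>eigenvalues M. [:-e, 1:])" "length (eigenvalues M) = n"
proof -
  obtain es where es: "char_poly M = (\<Prod>e\<leftarrow>es. [:-e, 1:])" "length es = n"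
    using symmetric_char_poly_splits[OF assms] by blast
  have "proots (char_poly M) = mset es"
    by (simp only: es(1) proots_linear_factors)
  hence ms: "mset (eigenvalues M) = mset es" by (simp add: eigenvalues_def)
  hence "(\<Prod>e\<leftarrow>eigenvalues M. [:-e, 1:]) = (\<Prod>e\<leftarrow>es. [:-e, 1:])"
    by (metis mset_map prod_mset_prod_list)
  thus "char_poly M = (\<Prod>e\<leftarrow>eigenvalues M. [:-e, 1:])" using es by simp
  show "length (eigenvalues M) = n" using ms es by (metis size_mset)
qed

lemma sorted_eigenvalues: "sorted (eigenvalues M)"
  by (simp add: eigenvalues_def)

text \<open>The positive semidefinite cone lies in its own dual: after diagonalising
  \<open>Q\<close> the pairing is a sum of eigenvalues of \<open>Q\<close> times diagonal entries of
  the rotated \<open>Z\<close>, and all of these are nonnegative.\<close>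

lemma mat_inner_psd_nonneg:
  assumes Q: "Q \<in> carrier_mat n n" "psd Q" and Z: "Z \<in> carrier_mat n n" "psd Z"
  shows "0 \<le> mat_inner Q Z"
proof -
  have sym: "symmetric_mat Q" using Q by (simp add: psd_def)
  obtain es where "char_poly Q = (\<Prod>e\<leftarrow>es. [:-e, 1:])"
    using char_poly_eigenvalues(1)[OF Q(1) sym] by blast
  then obtain U where U: "U \<in> carrier_mat n n" "U\<^sup>T * U = 1\<^sub>m n"
      "Q = U * mat_diag n (\<lambda>i. es ! i) * U\<^sup>T"
    using real_spectral_theorem[OF Q(1) sym] by blast
  define D where "D = mat_diag n (\<lambda>i. es ! i)"
  have D: "D \<in> carrier_mat n n" by (simp add: D_def)
  have "U\<^sup>T * Q * U = (U\<^sup>T * U) * D * (U\<^sup>T * U)"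
    unfolding U(3) D_def[symmetric] using U(1) D by (simp add: assoc_mult_mat[of _ n n _ n _ n])
  hence "U\<^sup>T * Q * U = D" using D by (simp add: U(2))
  hence "psd D" using psd_congruence[of "U\<^sup>T" n n Q] Q U by simp
  hence d: "0 \<le> es ! i" if "i < n" for i
    using psd_diag_nonneg[of D n i] D that by (simp add: D_def mat_diag_def)
  define R where "R = U\<^sup>T * Z * U"
  have R: "R \<in> carrier_mat n n" "psd R"
    using psd_congruence[of "U\<^sup>T" n n Z] Z U by (simp_all add: R_def)
  have "mat_inner Q Z = mat_inner D R"
    unfolding R_def by (subst U(3)) (simp add: mat_inner_congruence[OF U(1) _ Z(1)] D_def)
  also have "\<dots> = (\<Sum>i<n. \<Sum>j<n. if i = j then es ! i * R $$ (i, i) else 0)"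
    unfolding mat_inner_sum[OF D R(1)] by (intro sum.cong refl) (auto simp: D_def mat_diag_def)
  also have "\<dots> = (\<Sum>i<n. es ! i * R $$ (i, i))" by simp
  also have "\<dots> \<ge> 0" using d psd_diag_nonneg[OF R(2,1)] by (intro sum_nonneg) auto
  finally show ?thesis .
qed

subsection \<open>Kronecker products\<close>

lemma kron_carrier:
  "M \<in> carrier_mat a b \<Longrightarrow> N \<in> carrier_mat c d \<Longrightarrow> kron M N \<in> carrier_mat (a * c) (b * d)"
  by (auto simp: kron_def)

lemma kron_index:
  "M \<in> carrier_mat a b \<Longrightarrow> N \<in> carrier_mat c d \<Longrightarrow> i < a \<Longrightarrow> j < c \<Longrightarrow> k < b \<Longrightarrow> l < d \<Longrightarrow>
   kron M N $$ (i * c + j, k * d + l) = M $$ (i, k) * N $$ (j, l)"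
  by (simp add: kron_def pair_index_less)

lemma eq_mat_pairI:
  assumes "X \<in> carrier_mat (a * c) (b * d)" "Y \<in> carrier_mat (a * c) (b * d)"
    and "\<And>i j k l. i < a \<Longrightarrow> j < c \<Longrightarrow> k < b \<Longrightarrow> l < d \<Longrightarrow>
      X $$ (i * c + j, k * d + l) = Y $$ (i * c + j, k * d + l)"
  shows "X = Y"
proof (rule eq_matI)
  fix p q assume "p < dim_row Y" "q < dim_col Y"
  hence "p < a * c" "q < b * d" using assms(2) by auto
  thus "X $$ (p, q) = Y $$ (p, q)" using assms(3) by (metis pair_index_cases)
qed (use assms in auto)

lemma kron_transpose:
  assumes "M \<in> carrier_mat a b" "N \<in> carrier_mat c d"
  shows "(kron M N)\<^sup>T = kron M\<^sup>T N\<^sup>T"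
  using assms kron_carrier[OF assms] kron_carrier[of "M\<^sup>T" b a "N\<^sup>T" d c]
  by (intro eq_mat_pairI[of _ b d a c])
    (auto simp: kron_index[of _ a b _ c d] kron_index[of _ b a _ d c] pair_index_less)

lemma kron_mult:
  assumes A: "A \<in> carrier_mat a b" and C: "C \<in> carrier_mat b e"
    and B: "B \<in> carrier_mat c d" and D: "D \<in> carrier_mat d f"
  shows "kron A B * kron C D = kron (A * C) (B * D)"
proof (rule eq_mat_pairI[of _ a c e f])
  note AB = kron_carrier[OF A B] and CD = kron_carrier[OF C D]
  show "kron A B * kron C D \<in> carrier_mat (a * c) (e * f)" using AB CD by simp
  show "kron (A * C) (B * D) \<in> carrier_mat (a * c) (e * f)"
    using assms by (intro kron_carrier) auto
  fix i j k l assume l: "i < a" "j < c" "k < e" "l < f"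
  have "(kron A B * kron C D) $$ (i * c + j, k * f + l) =
      (\<Sum>x<b. \<Sum>y<d. (A $$ (i, x) * B $$ (j, y)) * (C $$ (x, k) * D $$ (y, l)))"
    using l by (simp add: mult_mat_index[OF AB CD] pair_index_less sum_lessThan_mult
        kron_index[OF A B] kron_index[OF C D] del: index_mult_mat(1))
  also have "\<dots> = (\<Sum>x<b. A $$ (i, x) * C $$ (x, k)) * (\<Sum>y<d. B $$ (j, y) * D $$ (y, l))"
    by (simp add: sum_product ac_simps)
  also have "\<dots> = kron (A * C) (B * D) $$ (i * c + j, k * f + l)"
    using l assms by (simp add: kron_index[of _ a e _ c f] mult_mat_index[OF A C] mult_mat_index[OF B D]
       del: index_mult_mat(1))
  finally show "(kron A B * kron C D) $$ (i * c + j, k * f + l) =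
    kron (A * C) (B * D) $$ (i * c + j, k * f + l)" .
qed

text \<open>Two uses of the mixed-product rule \<open>kron_mult\<close>; congruence by a Kronecker
  product acts separately on the two factors.\<close>

lemma kron_congruence:
  assumes P: "P \<in> carrier_mat a b" and B: "B \<in> carrier_mat b b"
    and R: "R \<in> carrier_mat c d" and A: "A \<in> carrier_mat d d"
  shows "kron P R * kron B A * (kron P R)\<^sup>T = kron (P * B * P\<^sup>T) (R * A * R\<^sup>T)"
  using assms by (simp add: kron_transpose[OF P R] kron_mult[OF P B R A]
      kron_mult[of _ a b _ a _ c d _ c])

lemma congruence_minus:
  fixes X Y :: "real mat"
  assumes W: "W \<in> carrier_mat N M" and "X \<in> carrier_mat M M" "Y \<in> carrier_mat M M"
  shows "W * (X - Y) * W\<^sup>T = W * X * W\<^sup>T - W * Y * W\<^sup>T"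
  using assms by (simp add: mult_minus_distrib_mat[of W N M X M Y]
      minus_mult_distrib_mat[of "W * X" N M "W * Y" "W\<^sup>T" N])

lemma mat_inner_kron:
  assumes M: "M \<in> carrier_mat m m" and N: "N \<in> carrier_mat n n"
    and Y: "Y \<in> carrier_mat (m * n) (m * n)"
  shows "mat_inner (kron M N) Y =
    (\<Sum>i<m. \<Sum>j<n. \<Sum>k<m. \<Sum>l<n. M $$ (i, k) * N $$ (j, l) * Y $$ (i * n + j, k * n + l))"
  using assms by (simp add: mat_inner_sum[OF kron_carrier[OF M N] Y] sum_lessThan_mult kron_index[OF M N])

lemma vec_of_mat_carrier: "X \<in> carrier_mat r c \<Longrightarrow> vec_of_mat X \<in> carrier_vec (c * r)"
  by (auto simp: vec_of_mat_def mult.commute)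

lemma vec_of_mat_index:
  "X \<in> carrier_mat r c \<Longrightarrow> k < c \<Longrightarrow> i < r \<Longrightarrow> vec_of_mat X $ (k * r + i) = X $$ (i, k)"
  using pair_index_less[of k c i r] by (simp add: vec_of_mat_def mult.commute)

text \<open>Stacking columns makes the column index the block index, so \<open>P\<close> acts on the
  columns of \<open>X\<close> and \<open>R\<close> on its rows. This identifies the compressed
  vector of the quadratic program with the transpose of \<open>kron V V\<close> applied to
  \<open>vec_of_mat X\<close>.\<close>

lemma kron_mult_vec_of_mat:
  assumes P: "P \<in> carrier_mat a b" and R: "R \<in> carrier_mat c d" and X: "X \<in> carrier_mat d b"
  shows "kron P R *\<^sub>v vec_of_mat X = vec_of_mat (R * X * P\<^sup>T)"
proof (rule eq_vecI)
  have RXP: "R * X * P\<^sup>T \<in> carrier_mat c a" using assms by simp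
  show "dim_vec (kron P R *\<^sub>v vec_of_mat X) = dim_vec (vec_of_mat (R * X * P\<^sup>T))"
    using vec_of_mat_carrier[OF RXP] kron_carrier[OF P R] by simp
  fix p assume "p < dim_vec (vec_of_mat (R * X * P\<^sup>T))"
  hence "p < a * c" using vec_of_mat_carrier[OF RXP] by simp
  then obtain k i where p: "k < a" "i < c" "p = k * c + i" by (rule pair_index_cases)
  have "(kron P R *\<^sub>v vec_of_mat X) $ p = (\<Sum>l<b. \<Sum>j<d. P $$ (k, l) * R $$ (i, j) * X $$ (j, l))"
    using p by (simp add: mult_mat_vec_index[OF kron_carrier[OF P R] vec_of_mat_carrier[OF X]]
      pair_index_less sum_lessThan_mult kron_index[OF P R] vec_of_mat_index[OF X] del: index_mult_mat_vec)
  also have "\<dots> = (\<Sum>l<b. (R * X) $$ (i, l) * P\<^sup>T $$ (l, k))"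
    using p P by (simp add: mult_mat_index[OF R X] sum_distrib_left sum_distrib_right ac_simps
       del: index_mult_mat(1))
  also have "\<dots> = (R * X * P\<^sup>T) $$ (i, k)"
    using p assms by (subst mult_mat_index[of "R * X" c b "P\<^sup>T" a]) auto
  finally show "(kron P R *\<^sub>v vec_of_mat X) $ p = vec_of_mat (R * X * P\<^sup>T) $ p"
    using p vec_of_mat_index[OF RXP] by simp
qed

section \<open>Kernels and rank-one corrections of positive semidefinite matrices\<close>

lemma quadratic_form_add_smult:
  fixes Y :: "real mat"
  assumes Y: "Y \<in> carrier_mat N N" "symmetric_mat Y" and x: "x \<in> carrier_vec N" and y: "y \<in> carrier_vec N"
  shows "(x + t \<cdot>\<^sub>v y) \<bullet> (Y *\<^sub>v (x + t \<cdot>\<^sub>v y)) =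
    x \<bullet> (Y *\<^sub>v x) + 2 * t * (x \<bullet> (Y *\<^sub>v y)) + t\<^sup>2 * (y \<bullet> (Y *\<^sub>v y))"
proof -
  have sym: "y \<bullet> (Y *\<^sub>v x) = x \<bullet> (Y *\<^sub>v y)"
    using Y x y quadratic_form_transpose[OF Y(1) y x] comm_scalar_prod[of "Y *\<^sub>v y" N x]
    by (simp add: symmetric_mat_def)
  have "Y *\<^sub>v (x + t \<cdot>\<^sub>v y) = Y *\<^sub>v x + t \<cdot>\<^sub>v (Y *\<^sub>v y)"
    using Y x y by (simp add: mult_add_distrib_mat_vec[of _ N N] mult_mat_vec[of _ N N])
  thus ?thesis
    using Y x y sym
    by (simp add: add_scalar_prod_distrib[of _ N] scalar_prod_add_distrib[of _ N] power2_eq_square algebra_simps)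
qed

text \<open>On the line from \<open>z\<close> in direction \<open>w = Y *\<^sub>v z\<close> the form
  is a quadratic polynomial in \<open>t\<close> without constant term. Its nonnegativity for all
  \<open>t\<close> forces the linear coefficient, twice the squared length of \<open>w\<close>, to
  vanish.\<close>

lemma psd_kernel:
  assumes psd: "psd Y" and Y: "Y \<in> carrier_mat N N" and z: "z \<in> carrier_vec N"
    and zero: "z \<bullet> (Y *\<^sub>v z) = 0"
  shows "Y *\<^sub>v z = 0\<^sub>v N"
proof -
  define w where "w = Y *\<^sub>v z"
  have w: "w \<in> carrier_vec N" using Y z by (simp add: w_def)
  have sym: "symmetric_mat Y" using psd by (simp add: psd_def)
  define c d where "c = w \<bullet> w" and "d = w \<bullet> (Y *\<^sub>v w)"
  have d: "0 \<le> d" using psd Y w by (simp add: psd_def d_def)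
  have "z \<bullet> (Y *\<^sub>v w) = c"
    using quadratic_form_transpose[OF Y z w] sym by (simp add: c_def w_def symmetric_mat_def)
  moreover have "0 \<le> (z + t \<cdot>\<^sub>v w) \<bullet> (Y *\<^sub>v (z + t \<cdot>\<^sub>v w))" for t
    using psd Y w z by (simp add: psd_def)
  ultimately have nonneg: "0 \<le> 2 * t * c + t\<^sup>2 * d" for t
    by (simp add: quadratic_form_add_smult[OF Y sym z w] zero d_def)
  have "c = 0"
  proof (rule ccontr)
    assume "c \<noteq> 0"
    \<comment> \<open>The step goes against the sign of \<open>c\<close>; the denominator
      \<open>d + 1\<close> is positive even when \<open>d = 0\<close>.\<close>
    define t where "t = - c / (d + 1)"
    have "2 * t * c + t\<^sup>2 * d = - (c\<^sup>2 * (d + 2)) / (d + 1)\<^sup>2"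
      using d by (simp add: t_def divide_simps power2_eq_square) (simp add: algebra_simps)
    also have "\<dots> < 0" using d \<open>c \<noteq> 0\<close> by simp
    finally show False using nonneg[of t] by simp
  qed
  thus ?thesis using conjugate_square_eq_0_vec[OF w] by (simp add: c_def w_def)
qed

text \<open>Unit vectors in the semi-inner product given by \<open>Y\<close> whose sum is as long as
  possible all coincide modulo the kernel of \<open>Y\<close>.\<close>

lemma unit_vectors_collapse:
  assumes psd: "psd Y" and Y: "Y \<in> carrier_mat N N"
    and u: "\<And>k. k < n \<Longrightarrow> u k \<in> carrier_vec N"
    and unit: "\<And>k. k < n \<Longrightarrow> u k \<bullet> (Y *\<^sub>v u k) = 1"
    and total: "(\<Sum>k<n. \<Sum>l<n. u k \<bullet> (Y *\<^sub>v u l)) = (real n)\<^sup>2"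
    and kl: "k < n" "l < n"
  shows "Y *\<^sub>v u k = Y *\<^sub>v u l"
proof -
  define g where "g k l = u k \<bullet> (Y *\<^sub>v u l)" for k l
  have sym: "symmetric_mat Y" using psd by (simp add: psd_def)
  have diff: "(u k + (-1) \<cdot>\<^sub>v u l) \<bullet> (Y *\<^sub>v (u k + (-1) \<cdot>\<^sub>v u l)) = 2 * (1 - g k l)"
    if "k < n" "l < n" for k l
    using quadratic_form_add_smult[OF Y sym u[OF that(1)] u[OF that(2)], of "-1"] unit that
    by (simp add: g_def)
  have "0 \<le> (u k + (-1) \<cdot>\<^sub>v u l) \<bullet> (Y *\<^sub>v (u k + (-1) \<cdot>\<^sub>v u l))" if "k < n" "l < n" for k l
    using psd Y u that by (simp add: psd_def)
  hence g: "0 \<le> 1 - g k l" if "k < n" "l < n" for k l using diff that by fastforce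
  \<comment> \<open>The numbers \<open>1 - g k l\<close> are nonnegative, and by
    \<open>total\<close> they sum to zero. So each of them is zero, every difference of two of the
    vectors has form value zero, and \<open>psd_kernel\<close> applies to it.\<close>
  have "(\<Sum>k<n. \<Sum>l<n. 1 - g k l) = 0"
    using total by (simp add: g_def sum_subtractf power2_eq_square)
  hence "(\<Sum>l<n. 1 - g k l) = 0"
    using g kl by (subst (asm) sum_nonneg_eq_0_iff) (auto intro: sum_nonneg)
  hence "1 - g k l = 0"
    using g kl by (subst (asm) sum_nonneg_eq_0_iff) auto
  hence "Y *\<^sub>v (u k + (-1) \<cdot>\<^sub>v u l) = 0\<^sub>v N"
    using diff[OF kl] u kl by (intro psd_kernel[OF psd Y]) auto
  moreover have "Y *\<^sub>v (u k + (-1) \<cdot>\<^sub>v u l) = Y *\<^sub>v u k + (-1) \<cdot>\<^sub>v (Y *\<^sub>v u l)"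
    using Y u[OF kl(1)] u[OF kl(2)] by (simp add: mult_add_distrib_mat_vec[of _ N N] mult_mat_vec[of _ N N])
  ultimately have eq: "Y *\<^sub>v u k + (-1) \<cdot>\<^sub>v (Y *\<^sub>v u l) = 0\<^sub>v N" by simp
  show ?thesis
  proof (rule eq_vecI)
    fix i assume "i < dim_vec (Y *\<^sub>v u l)"
    thus "(Y *\<^sub>v u k) $ i = (Y *\<^sub>v u l) $ i"
      using arg_cong[OF eq, of "\<lambda>v. v $ i"] Y u kl by simp
  qed simp
qed

definition outer :: "nat \<Rightarrow> real vec \<Rightarrow> real mat" where
  "outer N x = mat N N (\<lambda>(p, q). x $ p * x $ q)"

lemma outer_carrier [simp]: "outer N x \<in> carrier_mat N N"
  by (simp add: outer_def)

lemma symmetric_outer: "symmetric_mat (outer N x)"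
  by (auto simp: symmetric_mat_def outer_def)

lemma mat_inner_outer:
  assumes "M \<in> carrier_mat N N" "x \<in> carrier_vec N"
  shows "mat_inner M (outer N x) = x \<bullet> (M *\<^sub>v x)"
  unfolding mat_inner_sum[OF assms(1) outer_carrier] quadratic_form_sum[OF assms(1,2,2)]
  by (intro sum.cong refl) (simp add: outer_def)

lemma quadratic_form_outer:
  assumes "x \<in> carrier_vec N" "z \<in> carrier_vec N"
  shows "z \<bullet> (outer N x *\<^sub>v z) = (z \<bullet> x)\<^sup>2"
proof -
  have "z \<bullet> x = (\<Sum>i<N. z $ i * x $ i)" using assms by (simp add: scalar_prod_sum)
  thus ?thesis
    unfolding quadratic_form_sum[OF outer_carrier assms(2,2)]
    by (simp add: power2_eq_square sum_product) (intro sum.cong refl, simp add: outer_def)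
qed

lemma psd_outer:
  assumes "x \<in> carrier_vec N"
  shows "psd (outer N x)"
  using quadratic_form_outer[OF assms] symmetric_outer[of N x] by (simp add: psd_def outer_def)

text \<open>Completing the square: with \<open>x = Y *\<^sub>v u\<close> and
  \<open>c = z \<bullet> x\<close>, the form of \<open>Y\<close> at \<open>z\<close> minus
  \<open>c\<close> times \<open>u\<close> equals the form of \<open>Y\<close> at \<open>z\<close>
  minus the square of \<open>c\<close>, because \<open>u\<close> has unit length for
  \<open>Y\<close>.\<close>

lemma psd_minus_outer:
  assumes psd: "psd Y" and Y: "Y \<in> carrier_mat N N" and u: "u \<in> carrier_vec N"
    and unit: "u \<bullet> (Y *\<^sub>v u) = 1"
  shows "psd (Y - outer N (Y *\<^sub>v u))"
  unfolding psd_def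
proof (intro conjI ballI)
  have sym: "symmetric_mat Y" using psd by (simp add: psd_def)
  define x where "x = Y *\<^sub>v u"
  have x: "x \<in> carrier_vec N" using Y u by (simp add: x_def)
  show "symmetric_mat (Y - outer N (Y *\<^sub>v u))"
    using sym symmetric_outer[of N "Y *\<^sub>v u"] Y
    by (simp add: symmetric_mat_def transpose_minus[of _ N N])
  fix z :: "real vec" assume "z \<in> carrier_vec (dim_row (Y - outer N (Y *\<^sub>v u)))"
  hence z: "z \<in> carrier_vec N" by (simp add: outer_def)
  define c where "c = z \<bullet> x"
  have "0 \<le> (z + (-c) \<cdot>\<^sub>v u) \<bullet> (Y *\<^sub>v (z + (-c) \<cdot>\<^sub>v u))"
    using psd Y u z by (simp add: psd_def)
  also have "\<dots> = z \<bullet> (Y *\<^sub>v z) - c\<^sup>2"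
    by (simp add: quadratic_form_add_smult[OF Y sym z u] unit[folded x_def] x_def[symmetric] c_def[symmetric] power2_eq_square)
  also have "\<dots> = z \<bullet> ((Y - outer N x) *\<^sub>v z)"
    using Y z mult_mat_vec_carrier[OF outer_carrier z, of x] quadratic_form_outer[OF x z]
    by (simp add: minus_mult_distrib_mat_vec[of _ N N] scalar_prod_minus_distrib[of _ N] c_def)
  finally show "0 \<le> z \<bullet> ((Y - outer N (Y *\<^sub>v u)) *\<^sub>v z)" by (simp add: x_def)
qed

section \<open>Pairings with Kronecker products that have an identity factor\<close>

lemma mat_inner_kron_one_left:
  assumes N: "N \<in> carrier_mat n n" and Y: "Y \<in> carrier_mat (m * n) (m * n)"
  shows "mat_inner (kron (1\<^sub>m m) N) Y =
    (\<Sum>i<m. \<Sum>j<n. \<Sum>l<n. N $$ (j, l) * Y $$ (i * n + j, i * n + l))"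
proof -
  have "(\<Sum>k<m. \<Sum>l<n. (1\<^sub>m m :: real mat) $$ (i, k) * N $$ (j, l) * Y $$ (i * n + j, k * n + l)) =
      (\<Sum>k<m. if i = k then \<Sum>l<n. N $$ (j, l) * Y $$ (i * n + j, k * n + l) else 0)" if "i < m" for i j
    using that by (intro sum.cong refl) auto
  thus ?thesis by (simp add: mat_inner_kron[OF one_carrier_mat N Y])
qed

lemma mat_inner_kron_one_right:
  assumes M: "M \<in> carrier_mat m m" and Y: "Y \<in> carrier_mat (m * n) (m * n)"
  shows "mat_inner (kron M (1\<^sub>m n)) Y =
    (\<Sum>i<m. \<Sum>j<n. \<Sum>k<m. M $$ (i, k) * Y $$ (i * n + j, k * n + j))"
proof -
  have "(\<Sum>l<n. M $$ (i, k) * (1\<^sub>m n :: real mat) $$ (j, l) * Y $$ (i * n + j, k * n + l)) =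
      (\<Sum>l<n. if j = l then M $$ (i, k) * Y $$ (i * n + j, k * n + l) else 0)" if "j < n" for i j k
    using that by (intro sum.cong refl) auto
  thus ?thesis by (simp add: mat_inner_kron[OF M one_carrier_mat Y])
qed

text \<open>The delta is a factor rather than a case distinction, so that nested deltas can be moved
  out of inner sums by distributivity.\<close>

lemma sum_delta_mult:
  fixes f :: "'a \<Rightarrow> real"
  shows "finite A \<Longrightarrow> (\<Sum>l\<in>A. (if l = j then 1 else 0) * f l) = (if j \<in> A then f j else 0)"
  by (simp add: if_distrib[of "\<lambda>c. c * _"] cong: if_cong)

lemma unit_pos_mat_carrier [simp]: "unit_pos_mat n i j \<in> carrier_mat n n"
  by (simp add: unit_pos_mat_def)

lemma ones_mat_carrier [simp]: "ones_mat n \<in> carrier_mat n n"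
  by (simp add: ones_mat_def)

lemma ones_vec_carrier [simp]: "ones_vec n \<in> carrier_vec n"
  by (simp add: ones_vec_def)

lemma mat_inner_kron_one_unit:
  assumes Y: "Y \<in> carrier_mat (m * n) (m * n)" and j: "j < n"
  shows "mat_inner (kron (1\<^sub>m m) (unit_pos_mat n j j)) Y = (\<Sum>i<m. Y $$ (i * n + j, i * n + j))"
proof -
  have "(\<Sum>a<n. \<Sum>l<n. unit_pos_mat n j j $$ (a, l) * Y $$ (i * n + a, i * n + l)) =
      (\<Sum>a<n. (if a = j then 1 else 0) * (\<Sum>l<n. (if l = j then 1 else 0) * Y $$ (i * n + a, i * n + l)))" for i
    unfolding sum_distrib_left by (intro sum.cong refl) (simp add: unit_pos_mat_def)
  thus ?thesis using j by (simp add: mat_inner_kron_one_left[OF unit_pos_mat_carrier Y] sum_delta_mult)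
qed

lemma mat_inner_kron_unit_one:
  assumes Y: "Y \<in> carrier_mat (m * n) (m * n)" and i: "i < m"
  shows "mat_inner (kron (unit_pos_mat m i i) (1\<^sub>m n)) Y = (\<Sum>j<n. Y $$ (i * n + j, i * n + j))"
proof -
  have "mat_inner (kron (unit_pos_mat m i i) (1\<^sub>m n)) Y =
      (\<Sum>a<m. \<Sum>j<n. \<Sum>k<m. unit_pos_mat m i i $$ (a, k) * Y $$ (a * n + j, k * n + j))"
    by (rule mat_inner_kron_one_right[OF unit_pos_mat_carrier Y])
  also have "\<dots> = (\<Sum>a<m. (if a = i then 1 else 0) *
      (\<Sum>j<n. \<Sum>k<m. (if k = i then 1 else 0) * Y $$ (a * n + j, k * n + j)))"
    unfolding sum_distrib_left by (intro sum.cong refl) (simp add: unit_pos_mat_def)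
  finally show ?thesis using i by (simp add: sum_delta_mult)
qed

subsection \<open>Feasible points of the semidefinite program\<close>

text \<open>Here \<open>i\<close>, \<open>k\<close> number the blocks of \<open>Y\<close> and
  \<open>j\<close>, \<open>l\<close> the positions inside a block. When paired with
  \<open>kron B A\<close>, the former are indices of \<open>B\<close> and the latter indices of
  \<open>A\<close>.\<close>

definition sdp_entry :: "nat \<Rightarrow> real mat \<Rightarrow> nat \<Rightarrow> nat \<Rightarrow> nat \<Rightarrow> nat \<Rightarrow> real" where
  "sdp_entry n Y i j k l = Y $$ (i * n + j, k * n + l)"

lemma triple_sum_eq_0D:
  fixes f :: "nat \<Rightarrow> nat \<Rightarrow> nat \<Rightarrow> real"
  assumes nonneg: "\<And>i j k. i < n \<Longrightarrow> j < n \<Longrightarrow> k < n \<Longrightarrow> 0 \<le> f i j k"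
    and zero: "(\<Sum>i<n. \<Sum>j<n. \<Sum>k<n. f i j k) = 0" and "i < n" "j < n" "k < n"
  shows "f i j k = 0"
proof -
  have "(\<Sum>j<n. \<Sum>k<n. f i j k) = 0"
    by (rule sum_nonneg_0[OF _ _ zero]) (use assms in \<open>auto intro!: sum_nonneg\<close>)
  hence "(\<Sum>k<n. f i j k) = 0"
    by (rule sum_nonneg_0[rotated 2]) (use assms in \<open>auto intro!: sum_nonneg\<close>)
  thus ?thesis by (rule sum_nonneg_0[rotated 2]) (use assms in auto)
qed

text \<open>Most conclusions are the constraints read entrywise. The zero constraint is a single
  equation, but as the entries are nonnegative it makes every entry that it counts vanish.\<close>

lemma sdp_feasible_structure:
  assumes feas: "sdp_feasible n Y" and n: "n > 0"
  defines "y \<equiv> sdp_entry n Y"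
  shows sdp_carrier: "Y \<in> carrier_mat (n * n) (n * n)"
    and sdp_psd: "psd Y"
    and sdp_nonneg: "\<And>i j k l. i < n \<Longrightarrow> j < n \<Longrightarrow> k < n \<Longrightarrow> l < n \<Longrightarrow> 0 \<le> y i j k l"
    and sdp_sym: "\<And>i j k l. i < n \<Longrightarrow> j < n \<Longrightarrow> k < n \<Longrightarrow> l < n \<Longrightarrow> y i j k l = y k l i j"
    and sdp_diag_sum1: "\<And>j. j < n \<Longrightarrow> (\<Sum>i<n. y i j i j) = 1"
    and sdp_diag_sum2: "\<And>i. i < n \<Longrightarrow> (\<Sum>j<n. y i j i j) = 1"
    and sdp_zero1: "\<And>i j l. i < n \<Longrightarrow> j < n \<Longrightarrow> l < n \<Longrightarrow> j \<noteq> l \<Longrightarrow> y i j i l = 0"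
    and sdp_zero2: "\<And>i j k. i < n \<Longrightarrow> j < n \<Longrightarrow> k < n \<Longrightarrow> i \<noteq> k \<Longrightarrow> y i j k j = 0"
    and sdp_total: "(\<Sum>i<n. \<Sum>j<n. \<Sum>k<n. \<Sum>l<n. y i j k l) = (real n)\<^sup>2"
proof -
  show Y: "Y \<in> carrier_mat (n * n) (n * n)" and psd: "psd Y"
    using feas by (auto simp: sdp_feasible_def power2_eq_square)
  show nonneg: "0 \<le> y i j k l" if "i < n" "j < n" "k < n" "l < n" for i j k l
    using feas that by (simp add: sdp_feasible_def power2_eq_square y_def sdp_entry_def pair_index_less)
  show "y i j k l = y k l i j" if "i < n" "j < n" "k < n" "l < n" for i j k l
    unfolding y_def sdp_entry_def using psd that
    by (intro symmetric_mat_index[OF _ Y]) (auto simp: psd_def pair_index_less)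
  show "(\<Sum>i<n. y i j i j) = 1" if "j < n" for j
    using feas that mat_inner_kron_one_unit[OF Y that] by (simp add: sdp_feasible_def y_def sdp_entry_def)
  show "(\<Sum>j<n. y i j i j) = 1" if "i < n" for i
    using feas that mat_inner_kron_unit_one[OF Y that] by (simp add: sdp_feasible_def y_def sdp_entry_def)
  have "mat_inner (ones_mat (n * n)) Y = (\<Sum>p<n * n. \<Sum>q<n * n. Y $$ (p, q))"
    by (simp add: mat_inner_sum[OF ones_mat_carrier Y]) (simp add: ones_mat_def)
  thus "(\<Sum>i<n. \<Sum>j<n. \<Sum>k<n. \<Sum>l<n. y i j k l) = (real n)\<^sup>2"
    using feas by (simp add: sdp_feasible_def power2_eq_square sum_lessThan_mult y_def sdp_entry_def)
  let ?J = "ones_mat n - 1\<^sub>m n"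
  have J: "?J \<in> carrier_mat n n" by (intro minus_carrier_mat one_carrier_mat)
  have J_index: "?J $$ (i, j) = (if i = j then 0 else 1)" if "i < n" "j < n" for i j
    using that by (simp add: ones_mat_def)
  have "mat_inner (kron (1\<^sub>m n) ?J + kron ?J (1\<^sub>m n)) Y =
      mat_inner (kron (1\<^sub>m n) ?J) Y + mat_inner (kron ?J (1\<^sub>m n)) Y"
    by (intro mat_inner_add_left[of _ "n * n" "n * n"] kron_carrier J one_carrier_mat Y)
  moreover have "mat_inner (kron (1\<^sub>m n) ?J) Y = (\<Sum>i<n. \<Sum>j<n. \<Sum>l<n. if j = l then 0 else y i j i l)"
    by (simp add: mat_inner_kron_one_left[OF J Y] y_def sdp_entry_def del: index_minus_mat)
      (intro sum.cong refl, simp add: J_index y_def sdp_entry_def del: index_minus_mat)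
  moreover have "mat_inner (kron ?J (1\<^sub>m n)) Y = (\<Sum>i<n. \<Sum>j<n. \<Sum>k<n. if i = k then 0 else y i j k j)"
    by (simp add: mat_inner_kron_one_right[OF J Y] y_def sdp_entry_def del: index_minus_mat)
      (intro sum.cong refl, simp add: J_index y_def sdp_entry_def del: index_minus_mat)
  moreover have "0 \<le> (\<Sum>i<n. \<Sum>j<n. \<Sum>l<n. if j = l then 0 else y i j i l)"
    "0 \<le> (\<Sum>i<n. \<Sum>j<n. \<Sum>k<n. if i = k then 0 else y i j k j)"
    using nonneg by (auto intro!: sum_nonneg)
  ultimately have "(\<Sum>i<n. \<Sum>j<n. \<Sum>l<n. if j = l then 0 else y i j i l) = 0"
    "(\<Sum>i<n. \<Sum>j<n. \<Sum>k<n. if i = k then 0 else y i j k j) = 0"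
    using feas by (auto simp: sdp_feasible_def)
  note z = this
  show "y i j i l = 0" if "i < n" "j < n" "l < n" "j \<noteq> l" for i j l
    using triple_sum_eq_0D[OF _ z(1) that(1-3)] nonneg that by (simp split: if_splits)
  show "y i j k j = 0" if "i < n" "j < n" "k < n" "i \<noteq> k" for i j k
    using triple_sum_eq_0D[OF _ z(2) that(1-3)] nonneg that by (simp split: if_splits)
qed

text \<open>For the predicates used below the vector is the indicator of one block, or of one
  position taken in all blocks.\<close>

lemma block_sum_index:
  assumes Y: "Y \<in> carrier_mat (n * n) (n * n)" and "i < n" "j < n"
  shows "(Y *\<^sub>v vec (n * n) (\<lambda>p. if Q (p div n) (p mod n) then 1 else 0)) $ (i * n + j) =
    (\<Sum>k<n. \<Sum>l<n. if Q k l then sdp_entry n Y i j k l else (0::real))"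
  by (simp add: mult_mat_vec_index[OF Y] assms pair_index_less sum_lessThan_mult sdp_entry_def
      del: index_mult_mat_vec) (intro sum.cong refl, simp add: sdp_entry_def)

lemma sum_rotate:
  fixes h :: "'a \<Rightarrow> 'b \<Rightarrow> 'c \<Rightarrow> 'd::comm_monoid_add"
  shows "(\<Sum>i\<in>A. \<Sum>j\<in>B. \<Sum>k\<in>C. h i j k) = (\<Sum>k\<in>C. \<Sum>i\<in>A. \<Sum>j\<in>B. h i j k)"
proof -
  have "(\<Sum>i\<in>A. \<Sum>j\<in>B. \<Sum>k\<in>C. h i j k) = (\<Sum>i\<in>A. \<Sum>k\<in>C. \<Sum>j\<in>B. h i j k)"
    by (intro sum.cong refl sum.swap)
  also have "\<dots> = (\<Sum>k\<in>C. \<Sum>i\<in>A. \<Sum>j\<in>B. h i j k)" by (rule sum.swap)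
  finally show ?thesis .
qed

lemma sum_swap_pairs:
  fixes g :: "'a \<Rightarrow> 'b \<Rightarrow> 'c \<Rightarrow> 'd \<Rightarrow> 'e::comm_monoid_add"
  shows "(\<Sum>i\<in>A. \<Sum>j\<in>B. \<Sum>k\<in>C. \<Sum>l\<in>D. g i j k l) = (\<Sum>k\<in>C. \<Sum>l\<in>D. \<Sum>i\<in>A. \<Sum>j\<in>B. g i j k l)"
proof -
  have "(\<Sum>i\<in>A. \<Sum>j\<in>B. \<Sum>k\<in>C. \<Sum>l\<in>D. g i j k l) = (\<Sum>k\<in>C. \<Sum>i\<in>A. \<Sum>j\<in>B. \<Sum>l\<in>D. g i j k l)"
    by (rule sum_rotate)
  also have "\<dots> = (\<Sum>k\<in>C. \<Sum>l\<in>D. \<Sum>i\<in>A. \<Sum>j\<in>B. g i j k l)"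
    by (intro sum.cong refl sum_rotate)
  finally show ?thesis .
qed

text \<open>The block indicators \<open>u k\<close> and the position indicators \<open>v l\<close>
  both satisfy the hypotheses of \<open>unit_vectors_collapse\<close>. The common image under
  \<open>Y\<close> can therefore be evaluated with the index for which the zero pattern leaves a
  single diagonal entry.\<close>

lemma sdp_partial_sums:
  assumes feas: "sdp_feasible n Y" and n: "n > 0"
  defines "y \<equiv> sdp_entry n Y"
  shows sdp_row_sum: "\<And>i j k. i < n \<Longrightarrow> j < n \<Longrightarrow> k < n \<Longrightarrow> (\<Sum>l<n. y i j k l) = y i j i j"
    and sdp_col_sum: "\<And>i j l. i < n \<Longrightarrow> j < n \<Longrightarrow> l < n \<Longrightarrow> (\<Sum>k<n. y i j k l) = y i j i j"
    and sdp_minus_outer: "psd (Y - outer (n * n) (vec (n * n) (\<lambda>p. Y $$ (p, p))))"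
proof -
  note st = sdp_feasible_structure[OF feas n, folded y_def]
  note Y = st(1) and psd = st(2)
  define u where "u k = (vec (n * n) (\<lambda>p. if p div n = k then 1 else 0) :: real vec)" for k
  define v where "v l = (vec (n * n) (\<lambda>p. if p mod n = l then 1 else 0) :: real vec)" for l
  have uc: "u k \<in> carrier_vec (n * n)" and vc: "v k \<in> carrier_vec (n * n)" for k
    by (simp_all add: u_def v_def)
  have Yu: "(Y *\<^sub>v u k) $ (i * n + j) = (\<Sum>l<n. y i j k l)" if "i < n" "j < n" "k < n" for i j k
  proof -
    have "(\<Sum>l<n. if a = k then y i j a l else 0) = (if a = k then \<Sum>l<n. y i j a l else 0)" for a by simp
    thus ?thesis unfolding u_def
      using block_sum_index[OF Y that(1,2), of "\<lambda>a b. a = k", folded y_def] that by simp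
  qed
  have Yv: "(Y *\<^sub>v v l) $ (i * n + j) = (\<Sum>k<n. y i j k l)" if "i < n" "j < n" "l < n" for i j l
    unfolding v_def
    using block_sum_index[OF Y that(1,2), of "\<lambda>a b. b = l", folded y_def] that by simp
  have uu: "u i \<bullet> (Y *\<^sub>v u k) = (\<Sum>j<n. \<Sum>l<n. y i j k l)" if "i < n" "k < n" for i k
  proof -
    have "u i \<bullet> (Y *\<^sub>v u k) = (\<Sum>a<n. \<Sum>j<n. u i $ (a * n + j) * (\<Sum>l<n. y a j k l))"
      unfolding scalar_prod_sum[of "u i"] using that Y
      by (simp add: sum_lessThan_mult Yu del: index_mult_mat_vec)
    also have "\<dots> = (\<Sum>a<n. if a = i then \<Sum>j<n. \<Sum>l<n. y a j k l else 0)"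
      by (intro sum.cong refl) (auto simp: u_def pair_index_less)
    finally have "u i \<bullet> (Y *\<^sub>v u k) = (\<Sum>a<n. if a = i then \<Sum>j<n. \<Sum>l<n. y a j k l else 0)" .
    thus ?thesis using that by simp
  qed
  have vv: "v j \<bullet> (Y *\<^sub>v v l) = (\<Sum>i<n. \<Sum>k<n. y i j k l)" if "j < n" "l < n" for j l
  proof -
    have "v j \<bullet> (Y *\<^sub>v v l) = (\<Sum>i<n. \<Sum>b<n. v j $ (i * n + b) * (\<Sum>k<n. y i b k l))"
      unfolding scalar_prod_sum[of "v j"] using that Y
      by (simp add: sum_lessThan_mult Yv del: index_mult_mat_vec)
    also have "\<dots> = (\<Sum>i<n. \<Sum>b<n. if b = j then \<Sum>k<n. y i b k l else 0)"
      by (intro sum.cong refl) (auto simp: v_def pair_index_less)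
    finally have "v j \<bullet> (Y *\<^sub>v v l) = (\<Sum>i<n. \<Sum>b<n. if b = j then \<Sum>k<n. y i b k l else 0)" .
    thus ?thesis using that by simp
  qed
  have block: "(\<Sum>l<n. y i j i l) = y i j i j" if "i < n" "j < n" for i j
  proof -
    have "(\<Sum>l<n. y i j i l) = (\<Sum>l<n. if l = j then y i j i j else 0)"
      using st(7) that by (intro sum.cong refl) auto
    thus ?thesis using that by simp
  qed
  have cross: "(\<Sum>k<n. y i j k j) = y i j i j" if "i < n" "j < n" for i j
  proof -
    have "(\<Sum>k<n. y i j k j) = (\<Sum>k<n. if k = i then y i j i j else 0)"
      using st(8) that by (intro sum.cong refl) auto
    thus ?thesis using that by simp
  qed
  have unit_u: "u k \<bullet> (Y *\<^sub>v u k) = 1" if "k < n" for k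
    using that st(6) by (simp add: uu block)
  have unit_v: "v l \<bullet> (Y *\<^sub>v v l) = 1" if "l < n" for l
  proof -
    have "v l \<bullet> (Y *\<^sub>v v l) = (\<Sum>i<n. y i l i l)" using that by (simp add: vv cross)
    thus ?thesis using st(5) that by simp
  qed
  have "(\<Sum>k<n. \<Sum>l<n. u k \<bullet> (Y *\<^sub>v u l)) = (\<Sum>i<n. \<Sum>k<n. \<Sum>j<n. \<Sum>l<n. y i j k l)"
    by (simp add: uu)
  also have "\<dots> = (\<Sum>i<n. \<Sum>j<n. \<Sum>k<n. \<Sum>l<n. y i j k l)"
    by (intro sum.cong refl sum.swap)
  finally have total_u: "(\<Sum>k<n. \<Sum>l<n. u k \<bullet> (Y *\<^sub>v u l)) = (real n)\<^sup>2" using st(9) by simp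
  have "(\<Sum>k<n. \<Sum>l<n. v k \<bullet> (Y *\<^sub>v v l)) = (\<Sum>j<n. \<Sum>l<n. \<Sum>i<n. \<Sum>k<n. y i j k l)"
    by (simp add: vv)
  also have "\<dots> = (\<Sum>j<n. \<Sum>i<n. \<Sum>l<n. \<Sum>k<n. y i j k l)"
    by (intro sum.cong refl sum.swap)
  also have "\<dots> = (\<Sum>i<n. \<Sum>j<n. \<Sum>l<n. \<Sum>k<n. y i j k l)" by (rule sum.swap)
  also have "\<dots> = (\<Sum>i<n. \<Sum>j<n. \<Sum>k<n. \<Sum>l<n. y i j k l)"
    by (intro sum.cong refl sum.swap)
  finally have total_v: "(\<Sum>k<n. \<Sum>l<n. v k \<bullet> (Y *\<^sub>v v l)) = (real n)\<^sup>2" using st(9) by simp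
  \<comment> \<open>The sum over block \<open>k\<close> of a row agrees with its sum over block
    \<open>i\<close>, and there only the diagonal entry is nonzero.\<close>
  show row: "(\<Sum>l<n. y i j k l) = y i j i j" if "i < n" "j < n" "k < n" for i j k
    using unit_vectors_collapse[OF psd Y uc unit_u total_u that(3,1)] Yu[OF that] Yu[OF that(1,2,1)]
      block[OF that(1,2)] by simp
  show "(\<Sum>k<n. y i j k l) = y i j i j" if "i < n" "j < n" "l < n" for i j l
    using unit_vectors_collapse[OF psd Y vc unit_v total_v that(3,2)] Yv[OF that] Yv[OF that(1,2,2)]
      cross[OF that(1,2)] by simp
  \<comment> \<open>The unit vector \<open>u 0\<close> is thus mapped to the diagonal of
    \<open>Y\<close>, so \<open>psd_minus_outer\<close> subtracts exactly the outer product of the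
    diagonal.\<close>
  have "Y *\<^sub>v u 0 = vec (n * n) (\<lambda>p. Y $$ (p, p))"
  proof (rule eq_vecI)
    fix p assume "p < dim_vec (vec (n * n) (\<lambda>p. Y $$ (p, p)))"
    hence "p < n * n" by simp
    then obtain i j where p: "i < n" "j < n" "p = i * n + j" by (rule pair_index_cases)
    thus "(Y *\<^sub>v u 0) $ p = vec (n * n) (\<lambda>p. Y $$ (p, p)) $ p"
      using Yu[OF p(1,2) n] row[OF p(1,2) n] by (simp add: y_def sdp_entry_def pair_index_less del: index_mult_mat_vec)
  qed (use Y in simp)
  thus "psd (Y - outer (n * n) (vec (n * n) (\<lambda>p. Y $$ (p, p))))"
    using psd_minus_outer[OF psd Y uc unit_u[OF n]] by simp
qed

text \<open>In the following two lemmas, \<open>y i j k l\<close> stands for the entries of a feasible matrix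
  of the semidefinite program and \<open>d i j\<close> for its diagonal.\<close>

lemma partial_trace_projection:
  fixes y :: "nat \<Rightarrow> nat \<Rightarrow> nat \<Rightarrow> nat \<Rightarrow> real" and S :: "nat \<Rightarrow> nat \<Rightarrow> real"
  assumes row: "\<And>i j k l. i < n \<Longrightarrow> j < n \<Longrightarrow> l < n \<Longrightarrow> (\<Sum>k<n. y i j k l) = d i j"
    and zero: "\<And>i j l. i < n \<Longrightarrow> j < n \<Longrightarrow> l < n \<Longrightarrow> y i j i l = (if j = l then d i j else 0)"
    and d: "\<And>j. j < n \<Longrightarrow> (\<Sum>i<n. d i j) = 1"
    and S: "(\<Sum>j<n. \<Sum>l<n. S j l) = 0"
  shows "(\<Sum>i<n. \<Sum>j<n. \<Sum>k<n. \<Sum>l<n. ((if i = k then 1 else 0) - 1 / real n) * S j l * y i j k l) = (\<Sum>j<n. S j j)"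
proof -
  \<comment> \<open>The identity part keeps only \<open>k = i\<close>, where \<open>zero\<close>
    leaves only \<open>l = j\<close>. The part with \<open>1 / real n\<close> is summed over
    \<open>k\<close> first, using \<open>row\<close>; after summation over \<open>i\<close> and
    \<open>j\<close> it will vanish by the hypothesis on \<open>S\<close>.\<close>
  have inner: "(\<Sum>k<n. \<Sum>l<n. ((if i = k then 1 else 0) - 1 / real n) * S j l * y i j k l) =
      S j j * d i j - (1 / real n) * (\<Sum>l<n. S j l) * d i j" if ij: "i < n" "j < n" for i j
  proof -
    have "(\<Sum>k<n. \<Sum>l<n. ((if i = k then 1 else 0) - 1 / real n) * S j l * y i j k l) =
      (\<Sum>k<n. (if i = k then \<Sum>l<n. S j l * y i j k l else 0) - (\<Sum>l<n. (1 / real n) * S j l * y i j k l))"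
    proof (intro sum.cong refl)
      fix k
      show "(\<Sum>l<n. ((if i = k then 1 else 0) - 1 / real n) * S j l * y i j k l) =
        (if i = k then \<Sum>l<n. S j l * y i j k l else 0) - (\<Sum>l<n. (1 / real n) * S j l * y i j k l)"
        by (cases "i = k") (simp_all add: left_diff_distrib sum_subtractf sum_negf)
    qed
    also have "\<dots> = (\<Sum>l<n. S j l * y i j i l) - (\<Sum>k<n. \<Sum>l<n. (1 / real n) * S j l * y i j k l)"
      using ij by (simp add: sum_subtractf)
    also have "(\<Sum>k<n. \<Sum>l<n. (1 / real n) * S j l * y i j k l) = (\<Sum>l<n. \<Sum>k<n. (1 / real n) * S j l * y i j k l)"
      by (rule sum.swap)
    also have "(\<Sum>l<n. \<Sum>k<n. (1 / real n) * S j l * y i j k l) = (\<Sum>l<n. (1 / real n) * S j l * d i j)"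
      using ij by (simp add: sum_distrib_left[symmetric] sum_divide_distrib[symmetric] row)
    also have "(\<Sum>l<n. S j l * y i j i l) = (\<Sum>l<n. if l = j then S j j * d i j else 0)"
      using ij by (intro sum.cong refl) (auto simp: zero)
    finally show ?thesis using ij by (simp add: sum_distrib_left sum_distrib_right)
  qed
  have "(\<Sum>i<n. \<Sum>j<n. \<Sum>k<n. \<Sum>l<n. ((if i = k then 1 else 0) - 1 / real n) * S j l * y i j k l) =
      (\<Sum>i<n. \<Sum>j<n. (S j j - (1 / real n) * (\<Sum>l<n. S j l)) * d i j)"
    by (intro sum.cong refl, subst inner) (simp_all add: left_diff_distrib)
  also have "\<dots> = (\<Sum>j<n. (S j j - (1 / real n) * (\<Sum>l<n. S j l)) * (\<Sum>i<n. d i j))"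
    by (subst sum.swap) (simp only: sum_distrib_left)
  also have "\<dots> = (\<Sum>j<n. S j j) - (1 / real n) * (\<Sum>j<n. \<Sum>l<n. S j l)"
    by (simp add: d sum_subtractf sum_distrib_left)
  finally show ?thesis using S by simp
qed

lemma projected_kron_sum:
  fixes y :: "nat \<Rightarrow> nat \<Rightarrow> nat \<Rightarrow> nat \<Rightarrow> real" and A B :: "nat \<Rightarrow> nat \<Rightarrow> real"
  assumes n: "n > 0"
    and sym: "\<And>i j k l. i < n \<Longrightarrow> j < n \<Longrightarrow> k < n \<Longrightarrow> l < n \<Longrightarrow> y i j k l = y k l i j"
    and row: "\<And>i j k. i < n \<Longrightarrow> j < n \<Longrightarrow> k < n \<Longrightarrow> (\<Sum>l<n. y i j k l) = d i j"
    and col: "\<And>i j l. i < n \<Longrightarrow> j < n \<Longrightarrow> l < n \<Longrightarrow> (\<Sum>k<n. y i j k l) = d i j"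
    and d: "\<And>j. j < n \<Longrightarrow> (\<Sum>i<n. d i j) = 1"
    and A: "\<And>i j. i < n \<Longrightarrow> j < n \<Longrightarrow> A i j = A j i"
    and B: "\<And>i j. i < n \<Longrightarrow> j < n \<Longrightarrow> B i j = B j i"
  defines "a \<equiv> \<lambda>j. \<Sum>l<n. A j l" and "b \<equiv> \<lambda>i. \<Sum>k<n. B i k"
  defines "\<alpha> \<equiv> \<Sum>j<n. a j" and "\<beta> \<equiv> \<Sum>i<n. b i"
  defines "A' \<equiv> \<lambda>j l. A j l - (a j + a l) / real n + \<alpha> / (real n)\<^sup>2"
    and "B' \<equiv> \<lambda>i k. B i k - (b i + b k) / real n + \<beta> / (real n)\<^sup>2"
  shows "(\<Sum>i<n. \<Sum>j<n. \<Sum>k<n. \<Sum>l<n. B' i k * A' j l * y i j k l) =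
    (\<Sum>i<n. \<Sum>j<n. \<Sum>k<n. \<Sum>l<n. B i k * A j l * y i j k l)
    - 2 / real n * (\<Sum>i<n. \<Sum>j<n. b i * a j * d i j) + \<alpha> * \<beta> / (real n)\<^sup>2"
proof -
  define F where "F M N = (\<Sum>i<n. \<Sum>j<n. \<Sum>k<n. \<Sum>l<n. M i k * N j l * y i j k l)"
    for M N :: "nat \<Rightarrow> nat \<Rightarrow> real"
  \<comment> \<open>Symmetry of \<open>y\<close> reduces arguments that depend only on the second
    index of a pair to arguments that depend only on the first.\<close>
  have F_transpose: "F M N = F (\<lambda>i k. M k i) (\<lambda>j l. N l j)" for M N
  proof -
    have "F M N = (\<Sum>i<n. \<Sum>j<n. \<Sum>k<n. \<Sum>l<n. M i k * N j l * y k l i j)"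
      unfolding F_def by (intro sum.cong refl) (simp add: sym)
    also have "\<dots> = F (\<lambda>i k. M k i) (\<lambda>j l. N l j)"
      unfolding F_def by (rule sum_swap_pairs)
    finally show ?thesis .
  qed
  have F_row: "F M (\<lambda>j l. c j) = (\<Sum>i<n. \<Sum>j<n. (\<Sum>k<n. M i k) * c j * d i j)" for M c
    unfolding F_def by (intro sum.cong refl)
      (simp add: sum_distrib_left[symmetric] row, simp add: sum_distrib_right)
  have F_col: "F (\<lambda>i k. c i) N = (\<Sum>i<n. \<Sum>j<n. c i * (\<Sum>l<n. N j l) * d i j)" for N c
    unfolding F_def
  proof (intro sum.cong refl)
    fix i j assume "i \<in> {..<n}" "j \<in> {..<n}"
    hence ij: "i < n" "j < n" by auto
    have "(\<Sum>k<n. \<Sum>l<n. c i * N j l * y i j k l) = (\<Sum>l<n. \<Sum>k<n. c i * N j l * y i j k l)"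
      by (rule sum.swap)
    also have "\<dots> = c i * (\<Sum>l<n. N j l) * d i j"
      using ij by (simp add: sum_distrib_left[symmetric] col) (simp add: sum_distrib_right[symmetric] sum_distrib_left[symmetric])
    finally show "(\<Sum>k<n. \<Sum>l<n. c i * N j l * y i j k l) = c i * (\<Sum>l<n. N j l) * d i j" .
  qed
  have B'0: "(\<Sum>k<n. B' i k) = 0" if "i < n" for i
  proof -
    have "(\<Sum>k<n. B i k) = b i" "(\<Sum>k<n. b k) = \<beta>" by (simp_all add: b_def \<beta>_def)
    thus ?thesis using n
      by (simp add: B'_def sum.distrib sum_subtractf sum_divide_distrib[symmetric])
        (simp add: field_simps power2_eq_square)
  qed
  have F_right: "F M (\<lambda>j l. N1 j l - (N2 j l + N3 j l) / r + N4 j l / q) =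
      F M N1 - (F M N2 + F M N3) / r + F M N4 / q" for M N1 N2 N3 N4 r q
  proof -
    have "M i k * (N1 j l - (N2 j l + N3 j l) / r + N4 j l / q) * y i j k l =
      M i k * N1 j l * y i j k l - (M i k * N2 j l * y i j k l + M i k * N3 j l * y i j k l) / r
      + M i k * N4 j l * y i j k l / q" for i j k l
      by (simp add: algebra_simps add_divide_distrib)
    thus ?thesis unfolding F_def
      by (simp only: sum.distrib sum_subtractf sum_divide_distrib[symmetric])
  qed
  have F_left: "F (\<lambda>i k. M1 i k - (M2 i k + M3 i k) / r + M4 i k / q) N =
      F M1 N - (F M2 N + F M3 N) / r + F M4 N / q" for N M1 M2 M3 M4 r q
  proof -
    have "(M1 i k - (M2 i k + M3 i k) / r + M4 i k / q) * N j l * y i j k l =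
      M1 i k * N j l * y i j k l - (M2 i k * N j l * y i j k l + M3 i k * N j l * y i j k l) / r
      + M4 i k * N j l * y i j k l / q" for i j k l
      by (simp add: algebra_simps add_divide_distrib)
    thus ?thesis unfolding F_def
      by (simp only: sum.distrib sum_subtractf sum_divide_distrib[symmetric])
  qed
  \<comment> \<open>Each correction in \<open>A'\<close> depends on at most one of \<open>j\<close>
    and \<open>l\<close>. As the rows of \<open>B'\<close> sum to zero, these corrections contribute
    nothing and \<open>A'\<close> may be replaced by \<open>A\<close>. Only then is
    \<open>B'\<close> expanded; its two one-index corrections give the same linear term, whence the
    factor 2.\<close>
  have "F B' A' = F B' A - (F B' (\<lambda>j l. a j) + F B' (\<lambda>j l. a l)) / real n + F B' (\<lambda>j l. \<alpha>) / (real n)\<^sup>2"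
    unfolding A'_def by (rule F_right)
  moreover have z: "F B' (\<lambda>j l. c j) = 0" for c using F_row[of B' c] by (simp add: B'0)
  moreover have "F B' (\<lambda>j l. a l) = F (\<lambda>i k. B' k i) (\<lambda>j l. a j)" by (rule F_transpose)
  moreover have "F (\<lambda>i k. B' k i) (\<lambda>j l. a j) = F B' (\<lambda>j l. a j)"
    unfolding F_def using B by (intro sum.cong refl) (simp add: B'_def add.commute)
  ultimately have "F B' A' = F B' A" using z[of "\<lambda>_. \<alpha>"] by simp
  moreover have "F B' A = F B A - (F (\<lambda>i k. b i) A + F (\<lambda>i k. b k) A) / real n + F (\<lambda>i k. \<beta>) A / (real n)\<^sup>2"
    unfolding B'_def by (rule F_left)
  moreover have "F (\<lambda>i k. b k) A = F (\<lambda>i k. b i) (\<lambda>j l. A l j)" by (rule F_transpose)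
  moreover have "F (\<lambda>i k. b i) (\<lambda>j l. A l j) = F (\<lambda>i k. b i) A"
    unfolding F_def using A by (intro sum.cong refl) simp
  moreover have "F (\<lambda>i k. b i) A = (\<Sum>i<n. \<Sum>j<n. b i * a j * d i j)"
    by (simp add: F_col[of b A] a_def)
  moreover have "F (\<lambda>i k. \<beta>) A = \<alpha> * \<beta>"
  proof -
    have "F (\<lambda>i k. \<beta>) A = (\<Sum>i<n. \<Sum>j<n. \<beta> * a j * d i j)" by (simp add: F_col[of "\<lambda>_. \<beta>" A] a_def)
    also have "\<dots> = (\<Sum>j<n. \<beta> * a j * (\<Sum>i<n. d i j))" by (subst sum.swap) (simp only: sum_distrib_left)
    also have "\<dots> = \<alpha> * \<beta>" by (simp add: d \<alpha>_def sum_distrib_left mult.commute)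
    finally show ?thesis .
  qed
  ultimately have "F B' A' = F B A - ((\<Sum>i<n. \<Sum>j<n. b i * a j * d i j) + (\<Sum>i<n. \<Sum>j<n. b i * a j * d i j)) / real n
      + \<alpha> * \<beta> / (real n)\<^sup>2" by (simp only:)
  also have "\<dots> = F B A - 2 / real n * (\<Sum>i<n. \<Sum>j<n. b i * a j * d i j) + \<alpha> * \<beta> / (real n)\<^sup>2"
    by simp
  finally show ?thesis unfolding F_def .
qed

subsection \<open>Compression to the complement of the all-ones vector\<close>

text \<open>Adjoining the normalised all-ones vector to the columns of \<open>V\<close> gives a
  square matrix \<open>W\<close> with orthonormal columns, hence also orthonormal rows. Removing the
  contribution of the extra column from \<open>W * W\<^sup>T\<close> leaves the projection.\<close>

lemma onb_ones_complement_projection: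
  assumes onb: "onb_ones_complement n V" and n: "n > 0"
  shows onb_carrier: "V \<in> carrier_mat n (n - 1)"
    and onb_orthonormal: "V\<^sup>T * V = 1\<^sub>m (n - 1)"
    and onb_projection: "V * V\<^sup>T = mat n n (\<lambda>(i, k). (if i = k then 1 else 0) - 1 / real n)"
    and onb_col_sum: "\<And>j. j < n - 1 \<Longrightarrow> (\<Sum>i<n. V $$ (i, j)) = 0"
proof -
  interpret vec_space "TYPE(real)" n .
  show V: "V \<in> carrier_mat n (n - 1)" using onb by (simp add: onb_ones_complement_def)
  show VV: "V\<^sup>T * V = 1\<^sub>m (n - 1)"
    using onb V by (intro eq_matI) (auto simp: onb_ones_complement_def)
  show sum0: "(\<Sum>i<n. V $$ (i, j)) = 0" if j: "j < n - 1" for j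
  proof -
    have cV: "set (cols V) \<subseteq> carrier_vec n" using V by (auto simp: cols_def)
    have "col V j \<in> set (cols V)" using j V by (auto simp: cols_def)
    hence "col V j \<in> col_space V" unfolding col_space_def using in_own_span[OF cV] by blast
    hence "col V j \<bullet> ones_vec n = 0"
      using onb by (simp add: onb_ones_complement_def orthogonal_complement_def)
    thus ?thesis using j V by (simp add: scalar_prod_sum ones_vec_def)
  qed
  obtain m where m: "n = Suc m" using n by (cases n) auto
  \<comment> \<open>The extra column has index \<open>m = n - 1\<close>; for \<open>n = 1\<close> it
    is the only column of \<open>W\<close>.\<close>
  define W where "W = mat n n (\<lambda>(i, j). if j < m then V $$ (i, j) else 1 / sqrt (real n))"
  have W: "W \<in> carrier_mat n n" by (simp add: W_def)
  have VVi: "(\<Sum>k<n. V $$ (k, i) * V $$ (k, j)) = (if i = j then 1 else 0)" if "i < m" "j < m" for i j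
    using arg_cong[OF VV, of "\<lambda>M. M $$ (i, j)"] that V m
    by (simp add: mult_mat_index[of "V\<^sup>T" m n V m] del: index_mult_mat(1))
  have "W\<^sup>T * W = 1\<^sub>m n"
  proof (rule eq_matI)
    fix i j assume "i < dim_row (1\<^sub>m n :: real mat)" "j < dim_col (1\<^sub>m n :: real mat)"
    hence ij: "i < n" "j < n" by auto
    have "(W\<^sup>T * W) $$ (i, j) = (\<Sum>k<n. W $$ (k, i) * W $$ (k, j))"
      using ij W by (simp add: mult_mat_index[of "W\<^sup>T" n n W n] del: index_mult_mat(1))
    also have "\<dots> = (if i = j then 1 else 0)"
    proof (cases "i < m"; cases "j < m")
      assume "i < m" "j < m"
      thus ?thesis using VVi ij by (simp add: W_def)
    next
      assume a: "i < m" "\<not> j < m"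
      hence "(\<Sum>k<n. W $$ (k, i) * W $$ (k, j)) = (\<Sum>k<n. V $$ (k, i)) / sqrt (real n)"
        using ij by (simp add: W_def sum_divide_distrib)
      thus ?thesis using a sum0[of i] m by auto
    next
      assume a: "\<not> i < m" "j < m"
      hence "(\<Sum>k<n. W $$ (k, i) * W $$ (k, j)) = (\<Sum>k<n. V $$ (k, j)) / sqrt (real n)"
        using ij by (simp add: W_def sum_divide_distrib)
      thus ?thesis using a sum0[of j] m by auto
    next
      assume a: "\<not> i < m" "\<not> j < m"
      hence "(\<Sum>k<n. W $$ (k, i) * W $$ (k, j)) = (\<Sum>k<n. 1 / (sqrt (real n) * sqrt (real n)))"
        using ij by (simp add: W_def del: real_sqrt_mult_self)
      thus ?thesis using a ij m n by simp
    qed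
    finally show "(W\<^sup>T * W) $$ (i, j) = 1\<^sub>m n $$ (i, j)" using ij by simp
  qed (use W in auto)
  hence WW: "W * W\<^sup>T = 1\<^sub>m n" using W mat_mult_left_right_inverse[of "W\<^sup>T" n W] by simp
  show "V * V\<^sup>T = mat n n (\<lambda>(i, k). (if i = k then 1 else 0) - 1 / real n)"
  proof (rule eq_matI)
    fix i k assume "i < dim_row (mat n n (\<lambda>(i, k). (if i = k then 1 else 0) - 1 / real n))"
      "k < dim_col (mat n n (\<lambda>(i, k). (if i = k then 1 else 0) - 1 / real n))"
    hence ik: "i < n" "k < n" by auto
    have "(if i = k then 1 else 0) = (W * W\<^sup>T) $$ (i, k)" using ik by (simp add: WW)
    also have "\<dots> = (\<Sum>j<n. W $$ (i, j) * W $$ (k, j))"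
      using ik W by (simp add: mult_mat_index[of W n n "W\<^sup>T" n] del: index_mult_mat(1))
    also have "\<dots> = (\<Sum>j<m. V $$ (i, j) * V $$ (k, j)) + 1 / real n"
      using ik by (simp add: W_def m)
    also have "(\<Sum>j<m. V $$ (i, j) * V $$ (k, j)) = (V * V\<^sup>T) $$ (i, k)"
      using ik V m by (simp add: mult_mat_index[of V n m "V\<^sup>T" n] del: index_mult_mat(1))
    finally show "(V * V\<^sup>T) $$ (i, k) = mat n n (\<lambda>(i, k). (if i = k then 1 else 0) - 1 / real n) $$ (i, k)"
      using ik by simp
  qed (use V in auto)
qed

lemma lift_compress:
  fixes V M :: "real mat"
  assumes V: "V \<in> carrier_mat n m" and M: "M \<in> carrier_mat n n"
  shows "V * compress V M * V\<^sup>T = (V * V\<^sup>T) * M * (V * V\<^sup>T)"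
  unfolding compress_def using assms
    assoc_mult_mat[of V n m "V\<^sup>T * (M * V)" m "V\<^sup>T" n]
    assoc_mult_mat[of "V\<^sup>T" m n "M * V" m "V\<^sup>T" n]
    assoc_mult_mat[of V n m "V\<^sup>T * M" n "V * V\<^sup>T" n]
    assoc_mult_mat[of "V\<^sup>T" m n M n "V * V\<^sup>T" n]
  by simp

text \<open>This is double centering: the projection on each side subtracts means. The entries have
  the shape of \<open>A'\<close> and \<open>B'\<close> in \<open>projected_kron_sum\<close>.\<close>

lemma projected_entries:
  fixes M :: "real mat"
  assumes M: "M \<in> carrier_mat n n" "symmetric_mat M" and ik: "i < n" "k < n"
  defines "P \<equiv> mat n n (\<lambda>(i, k). (if i = k then 1 else 0) - 1 / real n)"
    and "r \<equiv> \<lambda>i. \<Sum>k<n. M $$ (i, k)"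
  shows "(P * M * P) $$ (i, k) =
    M $$ (i, k) - (r i + r k) / real n + (\<Sum>i<n. r i) / (real n)\<^sup>2"
proof -
  have P: "P \<in> carrier_mat n n" by (simp add: P_def)
  have PM: "(P * M) $$ (i, y) = M $$ (i, y) - r y / real n" if y: "y < n" for y
  proof -
    have "(P * M) $$ (i, y) = (\<Sum>x<n. (if i = x then M $$ (x, y) else 0) - M $$ (y, x) / real n)"
      using ik y symmetric_mat_index[OF M(2,1)]
      by (subst mult_mat_index[OF P M(1)]) (auto simp: P_def algebra_simps intro!: sum.cong)
    thus ?thesis using ik by (simp add: sum_subtractf r_def sum_divide_distrib)
  qed
  have "(P * M * P) $$ (i, k) = (\<Sum>y<n. (M $$ (i, y) - r y / real n) * P $$ (y, k))"
    using ik P M by (subst mult_mat_index[of "P * M" n n P n]) (simp_all add: PM del: index_mult_mat(1))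
  also have "\<dots> = (\<Sum>y<n. (if y = k then M $$ (i, y) - r y / real n else 0) - (M $$ (i, y) - r y / real n) / real n)"
    using ik by (intro sum.cong refl) (auto simp: P_def right_diff_distrib)
  also have "\<dots> = M $$ (i, k) - r k / real n - (r i - (\<Sum>y<n. r y) / real n) / real n"
    using ik by (simp add: sum_subtractf r_def sum_divide_distrib[symmetric])
  finally show ?thesis by (simp add: diff_divide_distrib add_divide_distrib power2_eq_square)
qed

text \<open>The trace is preserved by cyclicity and orthonormality of the columns of
  \<open>V\<close>, and the total vanishes because these columns sum to zero. The second fact
  supplies the hypothesis on \<open>S\<close> in \<open>partial_trace_projection\<close>.\<close>

lemma projected_dual_entries:
  fixes V S :: "real mat"
  assumes onb: "onb_ones_complement n V" and n: "n > 0" and S: "S \<in> carrier_mat (n - 1) (n - 1)"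
  shows "(\<Sum>j<n. (V * S * V\<^sup>T) $$ (j, j)) = mat_trace S"
    and "(\<Sum>j<n. \<Sum>l<n. (V * S * V\<^sup>T) $$ (j, l)) = 0"
proof -
  note V = onb_carrier[OF onb n]
  have "(\<Sum>j<n. (V * S * V\<^sup>T) $$ (j, j)) = mat_trace (V * (S * V\<^sup>T))"
    using V S by (simp add: mat_trace_def assoc_mult_mat[of V n "n - 1" S "n - 1" "V\<^sup>T" n])
  also have "\<dots> = mat_trace (S * V\<^sup>T * V)"
    using V S by (intro mat_trace_comm) auto
  also have "S * V\<^sup>T * V = S"
    using V S onb_orthonormal[OF onb n] by (simp add: assoc_mult_mat[of S "n - 1" "n - 1" "V\<^sup>T" n V "n - 1"])
  finally show "(\<Sum>j<n. (V * S * V\<^sup>T) $$ (j, j)) = mat_trace S" .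
  have "(\<Sum>l<n. (V * S * V\<^sup>T) $$ (j, l)) = 0" if "j < n" for j
  proof -
    have "(\<Sum>l<n. (V * S * V\<^sup>T) $$ (j, l)) = (\<Sum>l<n. \<Sum>k<n - 1. (V * S) $$ (j, k) * V $$ (l, k))"
      using that V S by (intro sum.cong refl, subst mult_mat_index[of _ n "n - 1" _ n]) auto
    also have "\<dots> = (\<Sum>k<n - 1. (V * S) $$ (j, k) * (\<Sum>l<n. V $$ (l, k)))"
      by (subst sum.swap) (simp only: sum_distrib_left)
    finally show ?thesis using onb_col_sum[OF onb n] by (simp del: index_mult_mat(1))
  qed
  thus "(\<Sum>j<n. \<Sum>l<n. (V * S * V\<^sup>T) $$ (j, l)) = 0" by (simp del: index_mult_mat(1))
qed

lemma compress_carrier: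
  "V \<in> carrier_mat n m \<Longrightarrow> M \<in> carrier_mat n n \<Longrightarrow> compress V M \<in> carrier_mat m m"
  by (simp add: compress_def)

text \<open>Congruence by \<open>kron V V\<close> acts factorwise and turns the identity factors
  into \<open>P\<close>. This brings \<open>Q_hat\<close> to the size of the semidefinite
  variable.\<close>

lemma lift_Q_hat:
  fixes V A B S T :: "real mat"
  assumes onb: "onb_ones_complement n V" and n: "n > 0"
    and A: "A \<in> carrier_mat n n" and B: "B \<in> carrier_mat n n"
    and S: "S \<in> carrier_mat (n - 1) (n - 1)" and T: "T \<in> carrier_mat (n - 1) (n - 1)"
  defines "P \<equiv> V * V\<^sup>T"
  shows "kron V V * Q_hat n V A B S T * (kron V V)\<^sup>T =
    kron (P * B * P) (P * A * P) - kron P (V * S * V\<^sup>T) - kron (V * T * V\<^sup>T) P"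
proof -
  note V = onb_carrier[OF onb n]
  have cB: "compress V B \<in> carrier_mat (n - 1) (n - 1)" "compress V A \<in> carrier_mat (n - 1) (n - 1)"
    using compress_carrier[OF V] A B by auto
  have c1: "kron (compress V B) (compress V A) \<in> carrier_mat ((n - 1) * (n - 1)) ((n - 1) * (n - 1))"
    and c2: "kron (1\<^sub>m (n - 1)) S \<in> carrier_mat ((n - 1) * (n - 1)) ((n - 1) * (n - 1))"
    and c3: "kron T (1\<^sub>m (n - 1)) \<in> carrier_mat ((n - 1) * (n - 1)) ((n - 1) * (n - 1))"
    using cB S T by (auto intro!: kron_carrier)
  note W = kron_carrier[OF V V]
  have "kron V V * Q_hat n V A B S T * (kron V V)\<^sup>T =
      kron V V * kron (compress V B) (compress V A) * (kron V V)\<^sup>T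
      - kron V V * kron (1\<^sub>m (n - 1)) S * (kron V V)\<^sup>T
      - kron V V * kron T (1\<^sub>m (n - 1)) * (kron V V)\<^sup>T"
    unfolding Q_hat_def
    by (simp only: congruence_minus[OF W minus_carrier_mat[OF c2] c3] congruence_minus[OF W c1 c2])
  also have "\<dots> = kron (P * B * P) (P * A * P) - kron P (V * S * V\<^sup>T) - kron (V * T * V\<^sup>T) P"
    using V by (simp only: kron_congruence[OF V cB(1) V cB(2)] kron_congruence[OF V one_carrier_mat V S]
      kron_congruence[OF V T V one_carrier_mat] lift_compress[OF V B] lift_compress[OF V A]
      right_mult_one_mat P_def)
  finally show ?thesis .
qed

lemma Q_hat_carrier:
  assumes "V \<in> carrier_mat n (n - 1)" "S \<in> carrier_mat (n - 1) (n - 1)" "T \<in> carrier_mat (n - 1) (n - 1)"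
  shows "Q_hat n V A B S T \<in> carrier_mat ((n - 1) * (n - 1)) ((n - 1) * (n - 1))"
  unfolding Q_hat_def by (intro minus_carrier_mat kron_carrier one_carrier_mat assms)

lemma quadratic_form_ones:
  "M \<in> carrier_mat n n \<Longrightarrow> ones_vec n \<bullet> (M *\<^sub>v ones_vec n) = (\<Sum>i<n. \<Sum>j<n. M $$ (i, j))"
  by (simp add: quadratic_form_sum[of M n] ) (simp add: ones_vec_def)

text \<open>The all-ones matrix has rank one, so the product is the outer product of row sums of
  \<open>M\<close> and column sums of \<open>N\<close>.\<close>

lemma mult_ones_mult_index:
  assumes M: "M \<in> carrier_mat n n" and N: "N \<in> carrier_mat n n" and ij: "i < n" "j < n"
  shows "(M * ones_mat n * N) $$ (i, j) = (\<Sum>k<n. M $$ (i, k)) * (\<Sum>l<n. N $$ (l, j))"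
proof -
  have "(M * ones_mat n) $$ (i, l) = (\<Sum>k<n. M $$ (i, k))" if "l < n" for l
    using that ij by (subst mult_mat_index[OF M ones_mat_carrier]) (simp_all add: ones_mat_def)
  thus ?thesis using ij M N
    by (subst mult_mat_index[of "M * ones_mat n" n n N n]) (simp_all add: sum_distrib_left del: index_mult_mat(1))
qed

lemma trace_linear_term:
  assumes A: "A \<in> carrier_mat n n" "symmetric_mat A" and B: "B \<in> carrier_mat n n" and X: "X \<in> carrier_mat n n"
  shows "mat_trace (B * ones_mat n * A * X) =
    (\<Sum>k<n. \<Sum>i<n. (\<Sum>l<n. B $$ (k, l)) * (\<Sum>j<n. A $$ (i, j)) * X $$ (i, k))"
proof -
  have BA: "B * ones_mat n * A \<in> carrier_mat n n"
    using A(1) B by (intro mult_carrier_mat[of _ n n] ones_mat_carrier)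
  have "(\<Sum>l<n. A $$ (l, i)) = (\<Sum>j<n. A $$ (i, j))" if "i < n" for i
    using symmetric_mat_index[OF A(2,1)] that by (intro sum.cong refl) simp
  hence "mat_trace (B * ones_mat n * A * X) =
      (\<Sum>k<n. \<Sum>i<n. (B * ones_mat n * A) $$ (k, i) * X $$ (i, k))"
    using BA X B by (simp add: mat_trace_def mult_mat_index[OF BA X] del: index_mult_mat(1) assoc_mult_mat)
  thus ?thesis using symmetric_mat_index[OF A(2,1)]
    by (simp add: mult_ones_mult_index[OF B A(1)] del: index_mult_mat(1))
qed

text \<open>The block index of \<open>Y\<close> becomes the column index of \<open>X\<close>, which
  matches column stacking; the two families of diagonal constraints become the row and column
  sums.\<close>

lemma diagonal_of_sdp_feasible:
  assumes feas: "sdp_feasible n Y" and n: "n > 0"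
  defines "X \<equiv> mat n n (\<lambda>(i, k). Y $$ (k * n + i, k * n + i))"
  shows "doubly_stochastic n X" "vec_of_mat X = vec (n * n) (\<lambda>p. Y $$ (p, p))"
proof -
  note st = sdp_feasible_structure[OF feas n]
  show "doubly_stochastic n X"
    using st(3,5,6) by (simp add: doubly_stochastic_def X_def sdp_entry_def)
  show "vec_of_mat X = vec (n * n) (\<lambda>p. Y $$ (p, p))"
    using n by (intro eq_vecI) (auto simp: vec_of_mat_def X_def less_mult_imp_div_less)
qed

text \<open>Pairing the lift \<open>L\<close> of \<open>Q_hat\<close> with the positive semidefinite
  matrix \<open>Y - outer (n * n) x\<close> bounds the quadratic term by
  \<open>mat_inner L Y\<close>. The three parts of \<open>L\<close> yield the semidefinite
  objective, linear and constant terms that cancel those of the quadratic objective, and minus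
  \<open>mat_trace (S + T)\<close>, which accounts for the trace on the left.\<close>

lemma QPB_objective_le_sdp:
  fixes V A B S T Y :: "real mat"
  assumes n: "n > 0" and A: "A \<in> carrier_mat n n" "symmetric_mat A"
    and B: "B \<in> carrier_mat n n" "symmetric_mat B"
    and onb: "onb_ones_complement n V"
    and dual: "dual_feasible n V A B (S, T)"
    and feas: "sdp_feasible n Y"
  defines "X \<equiv> mat n n (\<lambda>(i, k). Y $$ (k * n + i, k * n + i))"
  shows "QPB_objective n V A B S T X + mat_trace (S + T) \<le>
    mat_inner (kron B A) Y + min_inner (eigenvalues (compress V A)) (eigenvalues (compress V B))"
proof -
  have S: "S \<in> carrier_mat (n - 1) (n - 1)" and T: "T \<in> carrier_mat (n - 1) (n - 1)"
    and Q: "psd (Q_hat n V A B S T)" using dual by (auto simp: dual_feasible_def)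
  note V = onb_carrier[OF onb n]
  note st = sdp_feasible_structure[OF feas n] and ps = sdp_partial_sums[OF feas n]
  note Y = st(1)
  define y where "y = sdp_entry n Y"
  define d where "d i j = y i j i j" for i j
  define P where "P = V * V\<^sup>T"
  have P_index: "P $$ (i, k) = (if i = k then 1 else 0) - 1 / real n" if "i < n" "k < n" for i k
    using that by (simp add: P_def onb_projection[OF onb n])
  have P: "P \<in> carrier_mat n n" using V by (simp add: P_def)
  define S' where "S' = V * S * V\<^sup>T"
  define T' where "T' = V * T * V\<^sup>T"
  have S': "S' \<in> carrier_mat n n" and T': "T' \<in> carrier_mat n n"
    unfolding S'_def T'_def using V S T by (auto intro!: mult_carrier_mat[of _ n "n - 1"])
  have PMP: "P * M * P \<in> carrier_mat n n" if "M \<in> carrier_mat n n" for M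
    using P that by (intro mult_carrier_mat[of _ n n])
  define x where "x = vec_of_mat X"
  have X: "X \<in> carrier_mat n n" by (simp add: X_def)
  have x: "x \<in> carrier_vec (n * n)" unfolding x_def by (rule vec_of_mat_carrier[OF X])
  have x_diag: "x = vec (n * n) (\<lambda>p. Y $$ (p, p))"
    unfolding x_def X_def by (rule diagonal_of_sdp_feasible(2)[OF feas n])
  define W where "W = kron V V"
  have W: "W \<in> carrier_mat (n * n) ((n - 1) * (n - 1))" unfolding W_def by (rule kron_carrier[OF V V])
  define L where "L = W * Q_hat n V A B S T * W\<^sup>T"
  note Qc = Q_hat_carrier[OF V S T, of A B]
  have L: "L \<in> carrier_mat (n * n) (n * n)" "psd L"
    unfolding L_def using psd_congruence[OF W Qc Q] W Qc by (auto intro!: mult_carrier_mat[of _ "n * n" "(n - 1) * (n - 1)"])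
  have L_eq: "L = kron (P * B * P) (P * A * P) - kron P S' - kron T' P"
    unfolding L_def W_def P_def S'_def T'_def by (rule lift_Q_hat[OF onb n A(1) B(1) S T])

  \<comment> \<open>Hence the quadratic term of the objective is the form of \<open>L\<close> at
    \<open>x\<close>.\<close>
  have "W\<^sup>T *\<^sub>v x = vec_of_mat (V\<^sup>T * X * V)"
    unfolding W_def x_def kron_transpose[OF V V]
    using kron_mult_vec_of_mat[of "V\<^sup>T" "n - 1" n "V\<^sup>T" "n - 1" n X] V X by simp
  hence form: "vec_of_mat (V\<^sup>T * X * V) \<bullet> (Q_hat n V A B S T *\<^sub>v vec_of_mat (V\<^sup>T * X * V)) = mat_inner L (outer (n * n) x)"
  proof -
    have Wx: "W\<^sup>T *\<^sub>v x \<in> carrier_vec ((n - 1) * (n - 1))"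
      using W x by (intro mult_mat_vec_carrier[of _ _ "n * n"]) auto
    have "L *\<^sub>v x = W *\<^sub>v (Q_hat n V A B S T *\<^sub>v (W\<^sup>T *\<^sub>v x))"
      unfolding L_def
      using assoc_mult_mat_vec[OF mult_carrier_mat[OF W Qc], of "W\<^sup>T" "n * n" x] W x
        assoc_mult_mat_vec[OF W Qc Wx] by simp
    hence "x \<bullet> (L *\<^sub>v x) = (W\<^sup>T *\<^sub>v x) \<bullet> (Q_hat n V A B S T *\<^sub>v (W\<^sup>T *\<^sub>v x))"
      using quadratic_form_transpose[OF W x mult_mat_vec_carrier[OF Qc Wx]] by simp
    thus ?thesis using \<open>W\<^sup>T *\<^sub>v x = _\<close> by (simp add: mat_inner_outer[OF L(1) x])
  qed
  have "0 \<le> mat_inner L (Y - outer (n * n) x)"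
    using ps(3) by (intro mat_inner_psd_nonneg[OF L]) (auto simp: x_diag intro: minus_carrier_mat)
  hence quad: "mat_inner L (outer (n * n) x) \<le> mat_inner L Y"
    by (simp add: mat_inner_minus_right[OF Y outer_carrier L(1)])

  have kc: "kron (P * B * P) (P * A * P) \<in> carrier_mat (n * n) (n * n)"
    "kron P S' \<in> carrier_mat (n * n) (n * n)" "kron T' P \<in> carrier_mat (n * n) (n * n)"
    using PMP A B P S' T' by (auto intro!: kron_carrier)
  have split: "mat_inner L Y = mat_inner (kron (P * B * P) (P * A * P)) Y - mat_inner (kron P S') Y - mat_inner (kron T' P) Y"
    unfolding L_eq using kc Y
    by (simp only: mat_inner_minus_left[OF minus_carrier_mat[OF kc(2)] kc(3) Y] mat_inner_minus_left[OF kc(1,2) Y])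

  have row: "(\<Sum>l<n. y i j k l) = d i j" if "i < n" "j < n" "k < n" for i j k
    using ps(1)[OF that] by (simp add: y_def d_def)
  have col: "(\<Sum>k<n. y i j k l) = d i j" if "i < n" "j < n" "l < n" for i j l
    using ps(2)[OF that] by (simp add: y_def d_def)
  have sym: "y i j k l = y k l i j" if "i < n" "j < n" "k < n" "l < n" for i j k l
    using st(4)[OF that] by (simp add: y_def)
  have d1: "(\<Sum>i<n. d i j) = 1" if "j < n" for j using st(5)[OF that] by (simp add: d_def y_def)
  have d2: "(\<Sum>j<n. d i j) = 1" if "i < n" for i using st(6)[OF that] by (simp add: d_def y_def)
  have z1: "y i j i l = (if j = l then d i j else 0)" if "i < n" "j < n" "l < n" for i j l
    using st(7)[OF that] by (simp add: d_def y_def)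
  have z2: "y i j k j = (if i = k then d i j else 0)" if "i < n" "j < n" "k < n" for i j k
    using st(8)[OF that] by (simp add: d_def y_def)

  have trS: "mat_inner (kron P S') Y = mat_trace S"
  proof -
    have "mat_inner (kron P S') Y =
        (\<Sum>i<n. \<Sum>j<n. \<Sum>k<n. \<Sum>l<n. ((if i = k then 1 else 0) - 1 / real n) * S' $$ (j, l) * y i j k l)"
      unfolding mat_inner_kron[OF P S' Y]
      by (intro sum.cong refl) (simp add: P_index y_def sdp_entry_def)
    also have "\<dots> = (\<Sum>j<n. S' $$ (j, j))"
      using projected_dual_entries(2)[OF onb n S]
      by (intro partial_trace_projection[OF col z1 d1]) (simp_all add: S'_def)
    also have "\<dots> = mat_trace S" unfolding S'_def by (rule projected_dual_entries(1)[OF onb n S])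
    finally show ?thesis .
  qed
  have trT: "mat_inner (kron T' P) Y = mat_trace T"
  proof -
    have "mat_inner (kron T' P) Y =
        (\<Sum>i<n. \<Sum>j<n. \<Sum>k<n. \<Sum>l<n. T' $$ (i, k) * ((if j = l then 1 else 0) - 1 / real n) * y i j k l)"
      unfolding mat_inner_kron[OF T' P Y]
      by (intro sum.cong refl) (simp add: P_index y_def sdp_entry_def)
    \<comment> \<open>Blocks and positions exchange roles, so
      \<open>partial_trace_projection\<close> applies to the reordered sum with \<open>row\<close>,
      \<open>z2\<close>, \<open>d2\<close> in place of \<open>col\<close>, \<open>z1\<close>,
      \<open>d1\<close>.\<close>
    also have "\<dots> = (\<Sum>j<n. \<Sum>i<n. \<Sum>k<n. \<Sum>l<n. T' $$ (i, k) * ((if j = l then 1 else 0) - 1 / real n) * y i j k l)"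
      by (rule sum.swap)
    also have "\<dots> = (\<Sum>j<n. \<Sum>i<n. \<Sum>l<n. \<Sum>k<n. T' $$ (i, k) * ((if j = l then 1 else 0) - 1 / real n) * y i j k l)"
      by (intro sum.cong refl sum.swap)
    also have "\<dots> = (\<Sum>j<n. \<Sum>i<n. \<Sum>l<n. \<Sum>k<n. ((if j = l then 1 else 0) - 1 / real n) * T' $$ (i, k) * y i j k l)"
      by (intro sum.cong refl) (simp only: mult.commute)
    also have "\<dots> = (\<Sum>i<n. T' $$ (i, i))"
      using projected_dual_entries(2)[OF onb n T]
      by (intro partial_trace_projection[of n "\<lambda>j i l k. y i j k l" "\<lambda>j i. d i j"])
        (simp_all add: T'_def row z2 d2)
    also have "\<dots> = mat_trace T" unfolding T'_def by (rule projected_dual_entries(1)[OF onb n T])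
    finally show ?thesis .
  qed

  define a where "a j = (\<Sum>l<n. A $$ (j, l))" for j
  define b where "b i = (\<Sum>k<n. B $$ (i, k))" for i
  define \<alpha> where "\<alpha> = (\<Sum>j<n. a j)"
  define \<beta> where "\<beta> = (\<Sum>i<n. b i)"
  have P_mat: "P = mat n n (\<lambda>(i, k). (if i = k then 1 else 0) - 1 / real n)"
    unfolding P_def by (rule onb_projection[OF onb n])
  have "mat_inner (kron (P * B * P) (P * A * P)) Y =
      (\<Sum>i<n. \<Sum>j<n. \<Sum>k<n. \<Sum>l<n. (B $$ (i, k) - (b i + b k) / real n + \<beta> / (real n)\<^sup>2)
        * (A $$ (j, l) - (a j + a l) / real n + \<alpha> / (real n)\<^sup>2) * y i j k l)"
    unfolding mat_inner_kron[OF PMP[OF B(1)] PMP[OF A(1)] Y]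
    using projected_entries[OF A, folded P_mat] projected_entries[OF B, folded P_mat]
    by (intro sum.cong refl) (simp add: y_def sdp_entry_def a_def b_def \<alpha>_def \<beta>_def del: index_mult_mat(1) assoc_mult_mat)
  also have "\<dots> = (\<Sum>i<n. \<Sum>j<n. \<Sum>k<n. \<Sum>l<n. B $$ (i, k) * A $$ (j, l) * y i j k l)
    - 2 / real n * (\<Sum>i<n. \<Sum>j<n. b i * a j * d i j) + \<alpha> * \<beta> / (real n)\<^sup>2"
    unfolding a_def b_def \<alpha>_def \<beta>_def
    by (rule projected_kron_sum[OF n sym row col d1, of "\<lambda>j l. A $$ (j, l)" "\<lambda>i k. B $$ (i, k)"])
      (auto intro: symmetric_mat_index[OF A(2,1)] symmetric_mat_index[OF B(2,1)])
  also have "(\<Sum>i<n. \<Sum>j<n. \<Sum>k<n. \<Sum>l<n. B $$ (i, k) * A $$ (j, l) * y i j k l) = mat_inner (kron B A) Y"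
    unfolding mat_inner_kron[OF B(1) A(1) Y] by (simp add: y_def sdp_entry_def)
  also have "(\<Sum>i<n. \<Sum>j<n. b i * a j * d i j) = mat_trace (B * ones_mat n * A * X)"
    unfolding trace_linear_term[OF A B(1) X]
    by (intro sum.cong refl) (simp add: X_def a_def b_def d_def y_def sdp_entry_def)
  finally have main: "mat_inner (kron (P * B * P) (P * A * P)) Y = mat_inner (kron B A) Y
    - 2 / real n * mat_trace (B * ones_mat n * A * X) + \<alpha> * \<beta> / (real n)\<^sup>2" .
  have ab: "ones_vec n \<bullet> (A *\<^sub>v ones_vec n) = \<alpha>" "ones_vec n \<bullet> (B *\<^sub>v ones_vec n) = \<beta>"
    using A(1) B(1) by (simp_all add: quadratic_form_ones \<alpha>_def \<beta>_def a_def b_def)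
  show ?thesis
    unfolding QPB_objective_def Let_def form ab
    using quad split main trS trT mat_trace_add[OF S T] by simp
qed

subsection \<open>A dual point attaining the minimal scalar product\<close>

lemma mat_diag_minus:
  "mat_diag n f - mat_diag n g = mat_diag n (\<lambda>i. f i - g i :: real)"
  by (intro eq_matI) (auto simp: mat_diag_def)

lemma kron_mat_diag:
  "kron (mat_diag m f) (mat_diag n g) = mat_diag (m * n) (\<lambda>p. f (p div n) * g (p mod n))"
proof (rule eq_mat_pairI[of _ m n m n])
  show "kron (mat_diag m f) (mat_diag n g) \<in> carrier_mat (m * n) (m * n)"
    by (intro kron_carrier) simp_all
  fix i j k l assume "i < m" "j < n" "k < m" "l < n"
  moreover from this have "(i * n + j) div n = i" "(k * n + l) div n = k" "(i * n + j) mod n = j" "(k * n + l) mod n = l"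
    by simp_all
  hence "i * n + j = k * n + l \<longleftrightarrow> i = k \<and> j = l" by metis
  ultimately show "kron (mat_diag m f) (mat_diag n g) $$ (i * n + j, k * n + l) =
      mat_diag (m * n) (\<lambda>p. f (p div n) * g (p mod n)) $$ (i * n + j, k * n + l)"
    by (cases "i = k"; cases "j = l")
      (simp_all add: kron_index[of _ m m _ n n] mat_diag_def pair_index_less)
qed simp

text \<open>Optimal potentials of the assignment problem with costs \<open>a i * b j\<close> for increasing
  \<open>a\<close> and decreasing \<open>b\<close>, obtained by summing the increments along the diagonal.\<close>

lemma monotone_assignment_potentials:
  fixes a b :: "nat \<Rightarrow> real"
  assumes a: "\<And>i j. i \<le> j \<Longrightarrow> j < m \<Longrightarrow> a i \<le> a j"
    and b: "\<And>i j. i \<le> j \<Longrightarrow> j < m \<Longrightarrow> b j \<le> b i"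
  shows "\<exists>s t. (\<forall>i<m. s i + t i = a i * b i) \<and> (\<forall>i<m. \<forall>j<m. s i + t j \<le> a i * b j)"
proof -
  define s where "s i = (\<Sum>k<i. (a (Suc k) - a k) * b k)" for i
  define t where "t i = a i * b i - s i" for i
  \<comment> \<open>The difference of two values of \<open>s\<close> telescopes into increments of
    \<open>a\<close> weighted by values of \<open>b\<close>. Comparing every weight with
    \<open>b j\<close> gives both estimates: in \<open>up\<close> the index \<open>j\<close> is the
    lower end of the range, in \<open>down\<close> the upper end.\<close>
  have up: "s i - s j \<le> (a i - a j) * b j" if "j \<le> i" "i < m" for i j
    using that
  proof (induction i rule: dec_induct)
    case (step k)
    have "(a (Suc k) - a k) * b k \<le> (a (Suc k) - a k) * b j"
      using step.hyps step.prems a b by (intro mult_left_mono) auto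
    thus ?case using step by (simp add: s_def algebra_simps)
  qed simp
  have down: "(a j - a i) * b j \<le> s j - s i" if "i \<le> j" "j < m" for i j
    using that
  proof (induction j rule: dec_induct)
    case (step k)
    have "(a k - a i) * b (Suc k) \<le> (a k - a i) * b k"
      using step.hyps step.prems a b by (intro mult_left_mono) auto
    moreover have "(a (Suc k) - a k) * b (Suc k) \<le> (a (Suc k) - a k) * b k"
      using step.hyps step.prems a b by (intro mult_left_mono) auto
    ultimately show ?case using step by (simp add: s_def algebra_simps)
  qed simp
  have "s i + t j \<le> a i * b j" if "i < m" "j < m" for i j
    using up[of j i] down[of i j] that by (cases "j \<le> i") (auto simp: t_def algebra_simps)
  moreover have "s i + t i = a i * b i" for i by (simp add: t_def)
  ultimately show ?thesis by blast
qed

text \<open>The order-reversing permutation is a candidate in the minimum. It acts on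
  \<open>x\<close>, and reindexing the sum moves the reversal to \<open>y\<close>.\<close>

lemma min_inner_le_rev:
  assumes len: "length x = m" "length y = m"
  shows "min_inner x y \<le> (\<Sum>i<m. x ! i * rev y ! i)"
proof -
  define \<phi> where "\<phi> i = (if i < m then m - Suc i else i)" for i
  have perm: "\<phi> permutes {..<m}"
  proof (rule bij_imp_permutes)
    show "bij_betw \<phi> {..<m} {..<m}"
      by (rule bij_betw_byWitness[where f' = \<phi>]) (auto simp: \<phi>_def)
  qed (simp add: \<phi>_def)
  have "min_inner x y \<le> (\<Sum>i<m. x ! \<phi> i * y ! i)"
    unfolding min_inner_def len using perm finite_permutations[of "{..<m}"] by (intro Min_le) auto
  also have "\<dots> = (\<Sum>i<m. x ! (m - Suc i) * y ! i)" by (simp add: \<phi>_def)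
  also have "\<dots> = (\<Sum>i<m. x ! i * rev y ! i)"
    by (subst sum.nat_diff_reindex[symmetric]) (simp add: rev_nth len)
  finally show ?thesis .
qed

text \<open>Diagonalise \<open>M\<close> with increasing and \<open>N\<close> with decreasing
  eigenvalues, and rotate the potentials \<open>s\<close>, \<open>t\<close> by the same orthogonal
  matrices. The slack matrix is then congruent to a diagonal matrix whose entries are the
  nonnegative slacks of the assignment problem, and the traces add up to the scalar product of the
  oppositely ordered eigenvalues.\<close>

lemma dual_feasible_attaining_min_inner:
  fixes M N :: "real mat"
  assumes M: "M \<in> carrier_mat m m" "symmetric_mat M" and N: "N \<in> carrier_mat m m" "symmetric_mat N"
  obtains S T where "S \<in> carrier_mat m m" "symmetric_mat S" "T \<in> carrier_mat m m" "symmetric_mat T"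
    "psd (kron N M - kron (1\<^sub>m m) S - kron T (1\<^sub>m m))"
    "min_inner (eigenvalues M) (eigenvalues N) \<le> mat_trace (S + T)"
proof -
  define a where "a i = eigenvalues M ! i" for i
  define b where "b i = rev (eigenvalues N) ! i" for i
  note evM = char_poly_eigenvalues[OF M] and evN = char_poly_eigenvalues[OF N]
  obtain U where U: "U \<in> carrier_mat m m" "U\<^sup>T * U = 1\<^sub>m m" "M = U * mat_diag m a * U\<^sup>T"
    using real_spectral_theorem[OF M evM(1)] unfolding a_def by blast
  \<comment> \<open>Reversing the list of roots keeps the product and makes the prescribed diagonal
    decreasing.\<close>
  have "char_poly N = (\<Prod>e\<leftarrow>rev (eigenvalues N). [:-e, 1:])"
    by (subst evN(1)) (simp only: rev_map[symmetric] prod_list.rev)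
  then obtain W where W: "W \<in> carrier_mat m m" "W\<^sup>T * W = 1\<^sub>m m" "N = W * mat_diag m b * W\<^sup>T"
    using real_spectral_theorem[OF N] unfolding b_def by blast
  have UU: "U * U\<^sup>T = 1\<^sub>m m" and WW: "W * W\<^sup>T = 1\<^sub>m m"
    using mat_mult_left_right_inverse[of "U\<^sup>T" m U] mat_mult_left_right_inverse[of "W\<^sup>T" m W] U W by simp_all
  have mono_a: "a i \<le> a j" if "i \<le> j" "j < m" for i j
    using sorted_nth_mono[OF sorted_eigenvalues[of M]] that evM(2) by (simp add: a_def)
  have anti_b: "b j \<le> b i" if "i \<le> j" "j < m" for i j
    using sorted_nth_mono[OF sorted_eigenvalues[of N], of "m - Suc j" "m - Suc i"] that evN(2)
    by (simp add: b_def rev_nth)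
  obtain s t where st: "\<forall>i<m. s i + t i = a i * b i" "\<forall>i<m. \<forall>j<m. s i + t j \<le> a i * b j"
    using monotone_assignment_potentials[of m a b, OF mono_a anti_b] by auto
  define S where "S = U * mat_diag m s * U\<^sup>T"
  define T where "T = W * mat_diag m t * W\<^sup>T"
  have sym_diag: "symmetric_mat (mat_diag m f)" for f
    by (auto simp: symmetric_mat_def mat_diag_def)
  have S: "S \<in> carrier_mat m m" "symmetric_mat S"
    unfolding S_def using U by (auto intro!: symmetric_mat_congruence sym_diag mult_carrier_mat[of _ m m])
  have T: "T \<in> carrier_mat m m" "symmetric_mat T"
    unfolding T_def using W by (auto intro!: symmetric_mat_congruence sym_diag mult_carrier_mat[of _ m m])
  define D where "D = kron (mat_diag m b) (mat_diag m a) - kron (1\<^sub>m m) (mat_diag m s) - kron (mat_diag m t) (1\<^sub>m m)"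
  have kc: "kron (mat_diag m b) (mat_diag m a) \<in> carrier_mat (m * m) (m * m)"
    "kron (1\<^sub>m m) (mat_diag m s) \<in> carrier_mat (m * m) (m * m)"
    "kron (mat_diag m t) (1\<^sub>m m) \<in> carrier_mat (m * m) (m * m)"
    by (auto intro!: kron_carrier)
  have D: "D \<in> carrier_mat (m * m) (m * m)" unfolding D_def using kc by (intro minus_carrier_mat)
  have "D = mat_diag (m * m) (\<lambda>p. b (p div m) * a (p mod m) - s (p mod m) - t (p div m))"
    unfolding D_def mat_diag_one[symmetric] by (simp add: kron_mat_diag mat_diag_minus del: mat_diag_one)
  moreover have "0 \<le> b (p div m) * a (p mod m) - s (p mod m) - t (p div m)" if "p < m * m" for p
  proof -
    have "m > 0" using that by (cases m) auto
    hence "p mod m < m" "p div m < m" using that by (simp_all add: less_mult_imp_div_less)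
    thus ?thesis using st(2)[rule_format, of "p mod m" "p div m"] by (simp add: mult.commute)
  qed
  ultimately have "psd D" by (simp add: psd_mat_diag)
  hence "psd (kron W U * D * (kron W U)\<^sup>T)" by (rule psd_congruence[OF kron_carrier[OF W(1) U(1)] D])
  also have "kron W U * D * (kron W U)\<^sup>T = kron W U * kron (mat_diag m b) (mat_diag m a) * (kron W U)\<^sup>T
      - kron W U * kron (1\<^sub>m m) (mat_diag m s) * (kron W U)\<^sup>T - kron W U * kron (mat_diag m t) (1\<^sub>m m) * (kron W U)\<^sup>T"
    unfolding D_def
    by (simp only: congruence_minus[OF kron_carrier[OF W(1) U(1)] minus_carrier_mat[OF kc(2)] kc(3)]
      congruence_minus[OF kron_carrier[OF W(1) U(1)] kc(1,2)])
  also have "\<dots> = kron N M - kron (1\<^sub>m m) S - kron T (1\<^sub>m m)"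
    using W(1) U(1) by (simp only: kron_congruence[OF W(1) mat_diag_dim U(1) mat_diag_dim]
      kron_congruence[OF W(1) one_carrier_mat U(1) mat_diag_dim] kron_congruence[OF W(1) mat_diag_dim U(1) one_carrier_mat]
      W(3)[symmetric] U(3)[symmetric] S_def T_def right_mult_one_mat UU WW)
  finally have psd: "psd (kron N M - kron (1\<^sub>m m) S - kron T (1\<^sub>m m))" .
  have tr: "mat_trace (R * mat_diag m f * R\<^sup>T) = (\<Sum>i<m. f i)" if R: "R \<in> carrier_mat m m" "R\<^sup>T * R = 1\<^sub>m m" for R f
  proof -
    have "mat_trace (R * mat_diag m f * R\<^sup>T) = mat_trace (R\<^sup>T * (R * mat_diag m f))"
      using R by (intro mat_trace_comm[of _ m m]) auto
    also have "R\<^sup>T * (R * mat_diag m f) = mat_diag m f"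
      using R assoc_mult_mat[of "R\<^sup>T" m m R m "mat_diag m f" m] left_mult_one_mat[of "mat_diag m f" m m] by simp
    finally show ?thesis by (simp add: mat_trace_def mat_diag_def)
  qed
  have "mat_trace (S + T) = (\<Sum>i<m. s i) + (\<Sum>i<m. t i)"
    unfolding mat_trace_add[OF S(1) T(1)] unfolding S_def T_def tr[OF U(1,2)] tr[OF W(1,2)] ..
  also have "\<dots> = (\<Sum>i<m. a i * b i)"
    using st(1) by (simp add: sum.distrib[symmetric])
  finally have "mat_trace (S + T) = (\<Sum>i<m. a i * b i)" .
  moreover have "min_inner (eigenvalues M) (eigenvalues N) \<le> (\<Sum>i<m. a i * b i)"
    unfolding a_def b_def by (rule min_inner_le_rev[OF evM(2) evN(2)])
  ultimately show thesis using that S T psd by simp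
qed

subsection \<open>Linear functions on doubly stochastic matrices\<close>

text \<open>Induction on the total size of the sets. If all are singletons, the condition makes them
  distinct. Otherwise some \<open>S i\<close> has two elements, and one of these can be deleted
  without destroying the condition.\<close>

lemma hall_marriage:
  fixes S :: "'a \<Rightarrow> 'b set"
  assumes "finite I" "\<And>i. i \<in> I \<Longrightarrow> finite (S i)"
    and "\<And>J. J \<subseteq> I \<Longrightarrow> card J \<le> card (\<Union>(S ` J))"
  shows "\<exists>f. inj_on f I \<and> (\<forall>i\<in>I. f i \<in> S i)"
  using assms
proof (induction "\<Sum>i\<in>I. card (S i)" arbitrary: S rule: less_induct)
  case (less S)
  note finI = less.prems(1) and finS = less.prems(2) and hall = less.prems(3)
  have pos: "1 \<le> card (S i)" if "i \<in> I" for i using hall[of "{i}"] that by simp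
  show ?case
  proof (cases "\<forall>i\<in>I. card (S i) = 1")
    case True
    define f where "f i = the_elem (S i)" for i
    have f: "S i = {f i}" if "i \<in> I" for i
      using True that by (metis card_1_singletonE f_def the_elem_eq)
    have "i = j" if "i \<in> I" "j \<in> I" "f i = f j" for i j
      using hall[of "{i, j}"] f that by (cases "i = j") auto
    thus ?thesis using f by (auto simp: inj_on_def)
  next
    case False
    then obtain i where i: "i \<in> I" "card (S i) \<noteq> 1" by blast
    hence "\<not> card (S i) \<le> 1" using pos[OF i(1)] by simp
    then obtain x y where xy: "x \<in> S i" "y \<in> S i" "x \<noteq> y"
      using finS[OF i(1)] by (auto simp: card_le_Suc0_iff_eq)
    define R where "R z = S(i := S i - {z})" for z
    have RS: "R z k \<subseteq> S k" for z k by (simp add: R_def)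
    have finU: "finite (\<Union>(R z ` J))" if "J \<subseteq> I" for z J
      using that finI finS RS by (meson finite_UN_I finite_subset subset_eq)
    have "\<exists>z\<in>{x, y}. \<forall>J\<subseteq>I. card J \<le> card (\<Union>(R z ` J))"
    proof (rule ccontr)
      assume "\<not> ?thesis"
      then obtain J K where J: "J \<subseteq> I" "card (\<Union>(R x ` J)) < card J"
        and K: "K \<subseteq> I" "card (\<Union>(R y ` K)) < card K" by (auto simp: not_le)
      let ?A = "\<Union>(R x ` J)" and ?B = "\<Union>(R y ` K)"
      \<comment> \<open>Deletion changes only the set at \<open>i\<close>, so an index set that
        violates the condition afterwards must contain \<open>i\<close>.\<close>
      have iJ: "i \<in> J"
      proof (rule ccontr)
        assume "i \<notin> J"
        hence "R x ` J = S ` J" by (auto simp: R_def)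
        thus False using J hall[OF J(1)] by simp
      qed
      have iK: "i \<in> K"
      proof (rule ccontr)
        assume "i \<notin> K"
        hence "R y ` K = S ` K" by (auto simp: R_def)
        thus False using K hall[OF K(1)] by simp
      qed
      have fin: "finite J" "finite K" "finite ?A" "finite ?B"
        using J(1) K(1) finI finU finite_subset by blast+
      \<comment> \<open>Since \<open>x \<noteq> y\<close>, each element of \<open>S i\<close>
        survives at least one of the two deletions.\<close>
      have "\<Union>(S ` (J \<union> K)) \<subseteq> ?A \<union> ?B"
      proof
        fix z assume "z \<in> \<Union>(S ` (J \<union> K))"
        then obtain k where k: "k \<in> J \<union> K" "z \<in> S k" by blast
        show "z \<in> ?A \<union> ?B"
        proof (cases "k = i")
          case True
          hence "z \<in> R x i \<or> z \<in> R y i" using k xy by (auto simp: R_def)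
          thus ?thesis using iJ iK by blast
        next
          case False
          hence "z \<in> R x k" "z \<in> R y k" using k by (auto simp: R_def)
          thus ?thesis using k by blast
        qed
      qed
      hence "card (J \<union> K) \<le> card (?A \<union> ?B)"
        using hall[of "J \<union> K"] J K fin by (meson card_mono finite_UnI le_sup_iff order_trans)
      moreover have "\<Union>(S ` (J \<inter> K - {i})) \<subseteq> ?A \<inter> ?B" by (auto simp: R_def)
      hence "card (J \<inter> K - {i}) \<le> card (?A \<inter> ?B)"
        using hall[of "J \<inter> K - {i}"] J(1) fin
        by (meson Diff_subset card_mono finite_Int inf_le1 order_trans)
      hence "card (J \<inter> K) - 1 \<le> card (?A \<inter> ?B)" using iJ iK by simp
      moreover have "card (J \<inter> K) \<ge> 1" using iJ iK fin by (simp add: Suc_le_eq card_gt_0_iff) blast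
      moreover have "card ?A + card ?B = card (?A \<union> ?B) + card (?A \<inter> ?B)"
        using fin by (intro card_Un_Int)
      moreover have "card J + card K = card (J \<union> K) + card (J \<inter> K)"
        using fin by (intro card_Un_Int)
      \<comment> \<open>The sizes of \<open>?A\<close> and \<open>?B\<close> add up to at most
        \<open>card J + card K - 2\<close> by the two violations, but to at least
        \<open>card J + card K - 1\<close> by the counts for the union and for the intersection
        without \<open>i\<close>.\<close>
      ultimately show False using J(2) K(2) by linarith
    qed
    then obtain z where z: "z \<in> S i" and hallR: "\<And>J. J \<subseteq> I \<Longrightarrow> card J \<le> card (\<Union>(R z ` J))"
      using xy by blast
    have "(\<Sum>k\<in>I. card (R z k)) < (\<Sum>k\<in>I. card (S k))"
    proof (rule sum_strict_mono_ex1[OF finI])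
      show "\<forall>k\<in>I. card (R z k) \<le> card (S k)" using finS RS by (simp add: card_mono)
      show "\<exists>k\<in>I. card (R z k) < card (S k)"
        using i(1) finS[OF i(1)] z by (intro bexI[of _ i]) (auto simp: R_def simp del: card_Diff_insert card_Diff_singleton intro!: psubset_card_mono)
    qed
    moreover have "finite (R z k)" if "k \<in> I" for k using finS[OF that] RS finite_subset by blast
    ultimately obtain f where "inj_on f I" "\<forall>k\<in>I. f k \<in> R z k"
      using less.hyps[OF _ finI _ hallR] by blast
    thus ?thesis using RS by blast
  qed
qed

text \<open>Induction on the size of the support: Hall's theorem gives a permutation inside the
  support, and a multiple of its matrix can be subtracted so that an entry vanishes.\<close>

lemma assignment_lower_bound:
  fixes C X :: "nat \<Rightarrow> nat \<Rightarrow> real"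
  assumes n: "n > 0"
    and "\<And>i j. i < n \<Longrightarrow> j < n \<Longrightarrow> 0 \<le> X i j"
    and "\<And>i. i < n \<Longrightarrow> (\<Sum>j<n. X i j) = s"
    and "\<And>j. j < n \<Longrightarrow> (\<Sum>i<n. X i j) = s"
    and m: "\<And>\<phi>. \<phi> permutes {..<n} \<Longrightarrow> m \<le> (\<Sum>i<n. C i (\<phi> i))"
  shows "m * s \<le> (\<Sum>i<n. \<Sum>j<n. C i j * X i j)"
  using assms(2-4)
proof (induction "card {(i, j). i < n \<and> j < n \<and> X i j \<noteq> 0}" arbitrary: X s rule: less_induct)
  case (less X s)
  note nn = less.prems(1) and row = less.prems(2) and col = less.prems(3)
  have s: "0 \<le> s" using nn sum_nonneg[of "{..<n}" "X 0"] row[OF n] n by simp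
  show ?case
  proof (cases "s = 0")
    case True
    have "X i j = 0" if "i < n" "j < n" for i j
      using row[OF that(1)] True that nn[OF that(1)] sum_nonneg_eq_0_iff[of "{..<n}" "X i"] by simp
    thus ?thesis using True by simp
  next
    case False
    hence spos: "0 < s" using s by simp
    define N where "N i = {j. j < n \<and> X i j \<noteq> 0}" for i
    \<comment> \<open>Double counting: the rows in \<open>J\<close> have total
      \<open>s * card J\<close>, all of it placed in the columns of their supports, and each column
      has total \<open>s\<close>.\<close>
    have "card J \<le> card (\<Union>(N ` J))" if J: "J \<subseteq> {..<n}" for J
    proof -
      have fin: "finite J" using J finite_subset by blast
      have NU: "\<Union>(N ` J) \<subseteq> {..<n}" by (auto simp: N_def)
      have "s * card J = (\<Sum>i\<in>J. \<Sum>j<n. X i j)"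
        using J row by (simp add: subset_iff mult.commute)
      also have "\<dots> = (\<Sum>i\<in>J. \<Sum>j\<in>\<Union>(N ` J). X i j)"
        using NU by (intro sum.cong refl sum.mono_neutral_right) (auto simp: N_def)
      also have "\<dots> = (\<Sum>j\<in>\<Union>(N ` J). \<Sum>i\<in>J. X i j)" by (rule sum.swap)
      also have "\<dots> \<le> (\<Sum>j\<in>\<Union>(N ` J). \<Sum>i<n. X i j)"
        using J NU nn by (intro sum_mono sum_mono2) auto
      also have "\<dots> = (\<Sum>j\<in>\<Union>(N ` J). s)"
        using NU col by (intro sum.cong refl) auto
      finally have "s * card J \<le> s * card (\<Union>(N ` J))" by (simp add: mult.commute)
      thus ?thesis using spos by simp
    qed
    then obtain f where f: "inj_on f {..<n}" "\<forall>i\<in>{..<n}. f i \<in> N i"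
      using hall_marriage[of "{..<n}" N] by (auto simp: N_def)
    define \<phi> where "\<phi> i = (if i < n then f i else i)" for i
    have "\<phi> ` {..<n} \<subseteq> {..<n}" "inj_on \<phi> {..<n}"
      using f by (auto simp: \<phi>_def N_def inj_on_def)
    hence "bij_betw \<phi> {..<n} {..<n}"
      by (simp add: bij_betw_def endo_inj_surj)
    hence perm: "\<phi> permutes {..<n}" by (intro bij_imp_permutes) (auto simp: \<phi>_def)
    have Xpos: "0 < X i (\<phi> i)" and \<phi>n: "\<phi> i < n" if "i < n" for i
      using f(2) nn[of i "f i"] that by (auto simp: \<phi>_def N_def less_le)
    \<comment> \<open>The least entry along \<phi> is the largest multiple of the permutation matrix
      that can be subtracted without creating negative entries. The line sum drops from
      \<open>s\<close> to \<open>s - e\<close>, which is why the induction runs over arbitrary line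
      sums.\<close>
    define e where "e = Min ((\<lambda>i. X i (\<phi> i)) ` {..<n})"
    have "e \<in> (\<lambda>i. X i (\<phi> i)) ` {..<n}" unfolding e_def using n by (intro Min_in) auto
    then obtain k where k: "k < n" "e = X k (\<phi> k)" by auto
    have e: "0 \<le> e" "\<And>i. i < n \<Longrightarrow> e \<le> X i (\<phi> i)"
      using k(2) Xpos[OF k(1)] by simp (simp add: e_def Min_le)
    define X' where "X' i j = X i j - (if j = \<phi> i then e else 0)" for i j
    have "m * (s - e) \<le> (\<Sum>i<n. \<Sum>j<n. C i j * X' i j)"
    proof (rule less.hyps)
      have "X k (\<phi> k) \<noteq> 0" "X' k (\<phi> k) = 0" using Xpos[OF k(1)] k(2) by (auto simp: X'_def)
      moreover have "X' i j \<noteq> 0 \<Longrightarrow> X i j \<noteq> 0" if "i < n" for i j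
        using Xpos[OF that] by (auto simp: X'_def split: if_splits)
      ultimately have "{(i, j). i < n \<and> j < n \<and> X' i j \<noteq> 0} \<subset> {(i, j). i < n \<and> j < n \<and> X i j \<noteq> 0}"
        using k(1) \<phi>n[OF k(1)] by blast
      moreover have "finite {(i, j). i < n \<and> j < n \<and> X i j \<noteq> 0}"
        by (rule finite_subset[of _ "{..<n} \<times> {..<n}"]) auto
      ultimately show "card {(i, j). i < n \<and> j < n \<and> X' i j \<noteq> 0} < card {(i, j). i < n \<and> j < n \<and> X i j \<noteq> 0}"
        by (rule psubset_card_mono[rotated])
    next
      show "0 \<le> X' i j" if "i < n" "j < n" for i j using e nn that by (auto simp: X'_def)
      show "(\<Sum>j<n. X' i j) = s - e" if "i < n" for i
        using row[OF that] \<phi>n[OF that] by (simp add: X'_def sum_subtractf)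
      show "(\<Sum>i<n. X' i j) = s - e" if j: "j < n" for j
      proof -
        have "(\<Sum>i<n. if j = \<phi> i then e else 0) = (\<Sum>i<n. if i = inv_into UNIV \<phi> j then e else 0)"
          using permutes_inverses[OF perm] by (intro sum.cong refl) (auto)
        also have "\<dots> = e" using permutes_in_image[OF permutes_inv[OF perm], of j] j by simp
        finally show ?thesis using col[OF j] by (simp add: X'_def sum_subtractf)
      qed
    qed
    also have "\<dots> = (\<Sum>i<n. \<Sum>j<n. C i j * X i j) - e * (\<Sum>i<n. C i (\<phi> i))"
    proof -
      have "(\<Sum>j<n. C i j * X' i j) = (\<Sum>j<n. C i j * X i j) - e * C i (\<phi> i)" if "i < n" for i
      proof -
        have "(\<Sum>j<n. C i j * X' i j) = (\<Sum>j<n. C i j * X i j - (if j = \<phi> i then e * C i j else 0))"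
          by (intro sum.cong refl) (auto simp: X'_def algebra_simps)
        thus ?thesis using \<phi>n[OF that] by (simp add: sum_subtractf)
      qed
      thus ?thesis by (simp add: sum_subtractf sum_distrib_left)
    qed
    also have "\<dots> \<le> (\<Sum>i<n. \<Sum>j<n. C i j * X i j) - e * m"
      using m[OF perm] e(1) by (simp add: mult_left_mono)
    finally show ?thesis by (simp add: algebra_simps)
  qed
qed

subsection \<open>Attainment of the minima and permutations\<close>

text \<open>The quadratic term is nonnegative by dual feasibility. The coefficient of an entry of
  \<open>X\<close> in the trace term is the corresponding entry of \<open>D\<close>, so
  \<open>assignment_lower_bound\<close> with line sum 1 applies.\<close>

lemma PB_le_QPB_objective:
  fixes V A B S T X :: "real mat"
  assumes n: "n > 0" and A: "A \<in> carrier_mat n n" "symmetric_mat A"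
    and B: "B \<in> carrier_mat n n" "symmetric_mat B"
    and V: "V \<in> carrier_mat n (n - 1)"
    and dual: "dual_feasible n V A B (S, T)" and ds: "doubly_stochastic n X"
  shows "PB n V A B \<le> QPB_objective n V A B S T X"
proof -
  have S: "S \<in> carrier_mat (n - 1) (n - 1)" and T: "T \<in> carrier_mat (n - 1) (n - 1)"
    and Q: "psd (Q_hat n V A B S T)" using dual by (auto simp: dual_feasible_def)
  have X: "X \<in> carrier_mat n n" using ds by (simp add: doubly_stochastic_def)
  define D where "D = (2 / real n) \<cdot>\<^sub>m (A * ones_mat n * B)"
  define m where "m = Min ((\<lambda>\<phi>. \<Sum>i<n. D $$ (i, \<phi> i)) ` {\<phi>. \<phi> permutes {..<n}})"
  have AJB: "A * ones_mat n * B \<in> carrier_mat n n"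
    using A B by (intro mult_carrier_mat[of _ n n] ones_mat_carrier)
  have D_index: "D $$ (i, j) = 2 / real n * ((\<Sum>k<n. A $$ (i, k)) * (\<Sum>l<n. B $$ (j, l)))"
    if "i < n" "j < n" for i j
  proof -
    have "D $$ (i, j) = 2 / real n * (A * ones_mat n * B) $$ (i, j)"
      using that A(1) B(1) by (simp add: D_def del: index_mult_mat(1) assoc_mult_mat)
    also have "(A * ones_mat n * B) $$ (i, j) = (\<Sum>k<n. A $$ (i, k)) * (\<Sum>l<n. B $$ (l, j))"
      by (rule mult_ones_mult_index[OF A(1) B(1) that])
    also have "(\<Sum>l<n. B $$ (l, j)) = (\<Sum>l<n. B $$ (j, l))"
      using symmetric_mat_index[OF B(2,1)] that by (intro sum.cong refl) simp
    finally show ?thesis .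
  qed
  have "m \<le> (\<Sum>i<n. D $$ (i, \<phi> i))" if "\<phi> permutes {..<n}" for \<phi>
    unfolding m_def using that finite_permutations[of "{..<n}"] by (intro Min_le) auto
  hence "m * 1 \<le> (\<Sum>i<n. \<Sum>j<n. D $$ (i, j) * X $$ (i, j))"
    using ds by (intro assignment_lower_bound[OF n]) (auto simp: doubly_stochastic_def)
  also have "\<dots> = (\<Sum>i<n. \<Sum>j<n. 2 / real n * ((\<Sum>l<n. B $$ (j, l)) * (\<Sum>k<n. A $$ (i, k)) * X $$ (i, j)))"
    by (intro sum.cong refl) (simp add: D_index)
  also have "\<dots> = (\<Sum>j<n. \<Sum>i<n. 2 / real n * ((\<Sum>l<n. B $$ (j, l)) * (\<Sum>k<n. A $$ (i, k)) * X $$ (i, j)))"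
    by (rule sum.swap)
  also have "\<dots> = 2 / real n * mat_trace (B * ones_mat n * A * X)"
    unfolding trace_linear_term[OF A B(1) X] by (simp only: sum_distrib_left)
  finally have lin: "m \<le> 2 / real n * mat_trace (B * ones_mat n * A * X)" by simp
  have "V\<^sup>T * X * V \<in> carrier_mat (n - 1) (n - 1)" using V X by simp
  hence "vec_of_mat (V\<^sup>T * X * V) \<in> carrier_vec (dim_row (Q_hat n V A B S T))"
    using vec_of_mat_carrier[of "V\<^sup>T * X * V"] Q_hat_carrier[OF V S T, of A B] by simp
  hence "0 \<le> vec_of_mat (V\<^sup>T * X * V) \<bullet> (Q_hat n V A B S T *\<^sub>v vec_of_mat (V\<^sup>T * X * V))"
    using Q unfolding psd_def by blast
  thus ?thesis using lin unfolding PB_def QPB_objective_def Let_def D_def[symmetric] m_def[symmetric] by simp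
qed

section \<open>Attainment of the minima by compactness\<close>

lemma Least_attained:
  fixes g :: "'a \<Rightarrow> real"
  assumes "P M" "\<And>M'. P M' \<Longrightarrow> g M \<le> g M'"
  shows "(LEAST v. \<exists>X. P X \<and> v = g X) = g M"
  using assms by (intro Least_equality) auto

text \<open>Tychonoff's theorem for a product of compact intervals.\<close>

lemma compact_box:
  "compact {f :: 'i \<Rightarrow> real. \<forall>p. f p \<in> {0..c}}"
proof -
  have "compactin (product_topology (\<lambda>i::'i. euclidean) UNIV) (PiE UNIV (\<lambda>_. {0..c :: real}))"
    unfolding compactin_PiE by (simp add: compactin_euclidean_iff)
  moreover have "PiE UNIV (\<lambda>_. {0..c}) = {f :: 'i \<Rightarrow> real. \<forall>p. f p \<in> {0..c}}" by auto
  ultimately show ?thesis by (simp add: euclidean_product_topology compactin_euclidean_iff)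
qed

text \<open>Matrices are represented by functions on index pairs with the product topology, where
  the feasible set corresponds to a closed subset of a compact box.\<close>

lemma mat_minimum_attained:
  fixes P :: "real mat \<Rightarrow> bool" and g :: "real mat \<Rightarrow> real"
  assumes car: "\<And>M. P M \<Longrightarrow> M \<in> carrier_mat n n" and c: "0 \<le> c"
    and bounds: "\<And>M i j. P M \<Longrightarrow> i < n \<Longrightarrow> j < n \<Longrightarrow> 0 \<le> M $$ (i, j) \<and> M $$ (i, j) \<le> c"
    and ex: "\<exists>M. P M" and closed: "closed {f. P (mat n n f)}"
    and cont: "continuous_on UNIV (\<lambda>f. g (mat n n f))"
  shows "\<exists>M. P M \<and> (\<forall>M'. P M' \<longrightarrow> g M \<le> g M')"
proof -
  define K where "K = {f :: nat \<times> nat \<Rightarrow> real. \<forall>p. f p \<in> {0..c}} \<inter> {f. P (mat n n f)}"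
  \<comment> \<open>Extension by zero outside the index range gives a representative inside the box,
    since \<open>0 \<le> c\<close>.\<close>
  define e where "e M = (\<lambda>(i, j). if i < n \<and> j < n then M $$ (i, j) else 0)" for M :: "real mat"
  have mat_e: "mat n n (e M) = M" if "P M" for M
    using car[OF that] by (intro eq_matI) (auto simp: e_def)
  have eK: "e M \<in> K" if "P M" for M
  proof -
    have "e M p \<in> {0..c}" for p using bounds[OF that] c by (cases p) (simp add: e_def)
    thus ?thesis unfolding K_def using mat_e[OF that] that by auto
  qed
  have "compact K" unfolding K_def by (intro compact_Int_closed compact_box closed)
  moreover have "K \<noteq> {}" using ex eK by blast
  moreover have "continuous_on K (\<lambda>f. g (mat n n f))" using cont continuous_on_subset by blast
  ultimately obtain f where f: "f \<in> K" "\<forall>h\<in>K. g (mat n n f) \<le> g (mat n n h)"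
    using continuous_attains_inf by blast
  have "g (mat n n f) \<le> g M'" if "P M'" for M' using f(2) eK[OF that] mat_e[OF that] by metis
  thus ?thesis using f(1) unfolding K_def by blast
qed

lemma closed_Collect_ball_less:
  assumes "\<And>i. i < n \<Longrightarrow> closed {f. Q i f}"
  shows "closed {f. \<forall>i<n::nat. Q i f}"
proof -
  have "{f. \<forall>i<n. Q i f} = (\<Inter>i\<in>{..<n}. {f. Q i f})" by auto
  thus ?thesis using assms by (simp add: closed_INT)
qed

lemma continuous_on_mult_mat_entry:
  fixes F G :: "'a::topological_space \<Rightarrow> real mat"
  assumes "\<And>f. F f \<in> carrier_mat r m" "\<And>f. G f \<in> carrier_mat m c"
    and "\<And>i k. i < r \<Longrightarrow> k < m \<Longrightarrow> continuous_on UNIV (\<lambda>f. F f $$ (i, k))"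
    and "\<And>k j. k < m \<Longrightarrow> j < c \<Longrightarrow> continuous_on UNIV (\<lambda>f. G f $$ (k, j))"
    and "i < r" "j < c"
  shows "continuous_on UNIV (\<lambda>f. (F f * G f) $$ (i, j))"
  unfolding mult_mat_index[OF assms(1,2,5,6)] using assms by (intro continuous_intros) auto

lemma doubly_stochastic_minimum_attained:
  fixes g :: "real mat \<Rightarrow> real"
  assumes cont: "continuous_on UNIV (\<lambda>f. g (mat n n f))"
  shows "\<exists>X. doubly_stochastic n X \<and> (\<forall>X'. doubly_stochastic n X' \<longrightarrow> g X \<le> g X')"
proof (rule mat_minimum_attained[of _ n 1])
  show "M \<in> carrier_mat n n" if "doubly_stochastic n M" for M
    using that by (simp add: doubly_stochastic_def)
  show "0 \<le> M $$ (i, j) \<and> M $$ (i, j) \<le> 1" if M: "doubly_stochastic n M" and ij: "i < n" "j < n" for M i j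
  proof -
    have "M $$ (i, j) \<le> (\<Sum>l<n. M $$ (i, l))"
      using M ij by (intro member_le_sum) (auto simp: doubly_stochastic_def)
    thus ?thesis using M ij by (simp add: doubly_stochastic_def)
  qed
  have "doubly_stochastic n (1\<^sub>m n)" by (simp add: doubly_stochastic_def)
  thus "\<exists>M. doubly_stochastic n M" by blast
  have "closed {f. (\<forall>i<n. \<forall>j<n. 0 \<le> f (i, j)) \<and> (\<forall>i<n. (\<Sum>j<n. f (i, j)) = 1) \<and> (\<forall>j<n. (\<Sum>i<n. f (i, j)) = (1::real))}"
    by (intro closed_Collect_conj closed_Collect_ball_less closed_Collect_le closed_Collect_eq continuous_intros) auto
  thus "closed {f. doubly_stochastic n (mat n n f)}"
    by (simp add: doubly_stochastic_def)
qed (use cont in auto)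

lemma continuous_on_QPB_objective:
  assumes V: "V \<in> carrier_mat n (n - 1)" and A: "A \<in> carrier_mat n n" and B: "B \<in> carrier_mat n n"
    and S: "S \<in> carrier_mat (n - 1) (n - 1)" and T: "T \<in> carrier_mat (n - 1) (n - 1)"
  shows "continuous_on UNIV (\<lambda>f. QPB_objective n V A B S T (mat n n f))"
proof -
  note Q = Q_hat_carrier[OF V S T, of A B]
  have VXV: "V\<^sup>T * mat n n f * V \<in> carrier_mat (n - 1) (n - 1)" for f :: "nat \<times> nat \<Rightarrow> real"
    using V by (intro mult_carrier_mat[of _ _ n]) auto
  have y: "vec_of_mat (V\<^sup>T * mat n n f * V) \<in> carrier_vec ((n - 1) * (n - 1))" for f :: "nat \<times> nat \<Rightarrow> real"
    by (rule vec_of_mat_carrier[OF VXV])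
  have "continuous_on UNIV (\<lambda>f. (V\<^sup>T * mat n n f) $$ (i, j))" if "i < n - 1" "j < n" for i j
    using V that by (intro continuous_on_mult_mat_entry[of _ "n - 1" n _ n]) auto
  hence VXV_cont: "continuous_on UNIV (\<lambda>f. (V\<^sup>T * mat n n f * V) $$ (i, j))" if "i < n - 1" "j < n - 1" for i j
    using V that
    by (intro continuous_on_mult_mat_entry[of "\<lambda>f. V\<^sup>T * mat n n f" "n - 1" n "\<lambda>_. V" "n - 1"])
      (auto simp del: index_mult_mat(1) assoc_mult_mat)
  have y_cont: "continuous_on UNIV (\<lambda>f. vec_of_mat (V\<^sup>T * mat n n f * V) $ p)" if p: "p < (n - 1) * (n - 1)" for p
  proof -
    obtain k i where ki: "k < n - 1" "i < n - 1" "p = k * (n - 1) + i" using p by (rule pair_index_cases)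
    show ?thesis unfolding ki(3) vec_of_mat_index[OF VXV ki(1,2)] by (rule VXV_cont[OF ki(2,1)])
  qed
  have BJA: "B * ones_mat n * A \<in> carrier_mat n n"
    using A B by (intro mult_carrier_mat[of _ n n] ones_mat_carrier)
  have tr_cont: "continuous_on UNIV (\<lambda>f. mat_trace (B * ones_mat n * A * mat n n f))"
  proof -
    have "mat_trace (B * ones_mat n * A * mat n n f) = (\<Sum>i<n. (B * ones_mat n * A * mat n n f) $$ (i, i))" for f
      using B by (simp add: mat_trace_def)
    moreover have "continuous_on UNIV (\<lambda>f. (B * ones_mat n * A * mat n n f) $$ (i, i))" if "i < n" for i
      by (rule continuous_on_mult_mat_entry[of _ n n _ n])
        (use BJA that in \<open>auto simp del: index_mult_mat(1) assoc_mult_mat\<close>)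
    ultimately show ?thesis by (simp only:) (intro continuous_intros, simp)
  qed
  show ?thesis unfolding QPB_objective_def Let_def quadratic_form_sum[OF Q y y]
    by (intro continuous_intros y_cont tr_cont) auto
qed

lemma continuous_on_mat_inner:
  "C \<in> carrier_mat m n \<Longrightarrow> continuous_on UNIV (\<lambda>f. mat_inner C (mat m n f))"
  by (simp add: mat_inner_sum[of C m n]) (intro continuous_intros, auto)

text \<open>For a fixed vector the quadratic form is linear in the matrix entries, so the cone is an
  intersection of closed half-spaces with the closed conditions of symmetry.\<close>

lemma closed_psd: "closed {f. psd (mat n n f)}"
proof -
  have "psd (mat n n f) \<longleftrightarrow> (\<forall>i<n. \<forall>j<n. f (j, i) = f (i, j)) \<and>
      (\<forall>x\<in>carrier_vec n. 0 \<le> (\<Sum>i<n. \<Sum>j<n. x $ i * f (i, j) * x $ j))" for f :: "nat \<times> nat \<Rightarrow> real"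
  proof -
    have "symmetric_mat (mat n n f) \<longleftrightarrow> (\<forall>i<n. \<forall>j<n. f (j, i) = f (i, j))"
      by (auto simp: symmetric_mat_def mat_eq_iff)
    moreover have "x \<bullet> (mat n n f *\<^sub>v x) = (\<Sum>i<n. \<Sum>j<n. x $ i * f (i, j) * x $ j)" if "x \<in> carrier_vec n" for x
      using quadratic_form_sum[OF mat_carrier[of n n f] that that] by simp
    ultimately show ?thesis by (simp add: psd_def)
  qed
  moreover have "closed {f :: nat \<times> nat \<Rightarrow> real. \<forall>x\<in>carrier_vec n. 0 \<le> (\<Sum>i<n. \<Sum>j<n. x $ i * f (i, j) * x $ j)}"
  proof -
    have "{f. \<forall>x\<in>carrier_vec n. 0 \<le> (\<Sum>i<n. \<Sum>j<n. x $ i * f (i, j) * x $ j)} =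
        (\<Inter>x\<in>carrier_vec n. {f :: nat \<times> nat \<Rightarrow> real. 0 \<le> (\<Sum>i<n. \<Sum>j<n. x $ i * f (i, j) * x $ j)})" by auto
    moreover have "closed {f :: nat \<times> nat \<Rightarrow> real. 0 \<le> (\<Sum>i<n. \<Sum>j<n. x $ i * f (i, j) * x $ j)}" for x
      by (intro closed_Collect_le continuous_intros) auto
    ultimately show ?thesis by (simp add: closed_INT)
  qed
  ultimately show ?thesis
    by (simp only:) (intro closed_Collect_conj closed_Collect_ball_less closed_Collect_eq, auto)
qed

text \<open>Feasible entries are nonnegative and sum to the square of \<open>n\<close>, which bounds
  each of them; all constraints are closed.\<close>

lemma sdp_minimum_attained:
  assumes C: "C \<in> carrier_mat (n * n) (n * n)" and ex: "\<exists>Y. sdp_feasible n Y"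
  shows "\<exists>Y. sdp_feasible n Y \<and> (\<forall>Y'. sdp_feasible n Y' \<longrightarrow> mat_inner C Y \<le> mat_inner C Y')"
proof (rule mat_minimum_attained[of _ "n * n" "(real n)\<^sup>2"])
  show "M \<in> carrier_mat (n * n) (n * n)" if "sdp_feasible n M" for M
    using that by (simp add: sdp_feasible_def power2_eq_square)
  show "0 \<le> M $$ (p, q) \<and> M $$ (p, q) \<le> (real n)\<^sup>2"
    if M: "sdp_feasible n M" and pq: "p < n * n" "q < n * n" for M p q
  proof -
    have Mc: "M \<in> carrier_mat (n * n) (n * n)" and nn: "0 \<le> M $$ (i, j)" if "i < n * n" "j < n * n" for i j
      using M that by (auto simp: sdp_feasible_def power2_eq_square)
    have "M $$ (p, q) \<le> (\<Sum>j<n * n. M $$ (p, j))"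
      using nn pq by (intro member_le_sum) auto
    also have "\<dots> \<le> (\<Sum>i<n * n. \<Sum>j<n * n. M $$ (i, j))"
      using nn pq by (intro member_le_sum[of p]) (auto intro: sum_nonneg)
    also have "\<dots> = mat_inner (ones_mat (n * n)) M"
      by (simp add: mat_inner_sum[OF ones_mat_carrier Mc[OF pq]]) (simp add: ones_mat_def)
    finally show ?thesis using M nn[OF pq] by (simp add: sdp_feasible_def power2_eq_square)
  qed
  have J: "ones_mat n - 1\<^sub>m n \<in> carrier_mat n n" by (intro minus_carrier_mat one_carrier_mat)
  have "closed {f. psd (mat (n * n) (n * n) f) \<and>
     (\<forall>i<n * n. \<forall>j<n * n. 0 \<le> f (i, j)) \<and>
     (\<forall>j<n. mat_inner (kron (1\<^sub>m n) (unit_pos_mat n j j)) (mat (n * n) (n * n) f) = 1) \<and>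
     (\<forall>j<n. mat_inner (kron (unit_pos_mat n j j) (1\<^sub>m n)) (mat (n * n) (n * n) f) = 1) \<and>
     mat_inner (kron (1\<^sub>m n) (ones_mat n - 1\<^sub>m n) + kron (ones_mat n - 1\<^sub>m n) (1\<^sub>m n)) (mat (n * n) (n * n) f) = 0 \<and>
     mat_inner (ones_mat (n * n)) (mat (n * n) (n * n) f) = (real n)\<^sup>2}"
    by (intro closed_Collect_conj closed_psd closed_Collect_ball_less closed_Collect_le closed_Collect_eq
        continuous_on_mat_inner continuous_on_const continuous_on_product_coordinates
        add_carrier_mat kron_carrier J one_carrier_mat unit_pos_mat_carrier ones_mat_carrier)
  thus "closed {f. sdp_feasible n (mat (n * n) (n * n) f)}"
    by (simp add: sdp_feasible_def power2_eq_square)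
qed (use ex continuous_on_mat_inner[OF C] in auto)

text \<open>The vector is the column stacking of the permutation matrix with ones at row
  \<open>j\<close> and column \<open>\<phi> j\<close>. Pairing its outer product with
  \<open>kron M N\<close> evaluates \<open>M\<close> at permuted indices and \<open>N\<close> at the
  original ones; this one formula, \<open>inner\<close>, gives the objective and all the equality
  constraints.\<close>

lemma permutation_sdp_feasible:
  assumes perm: "\<phi> permutes {..<n}"
  defines "Y \<equiv> outer (n * n) (vec (n * n) (\<lambda>p. if p div n = \<phi> (p mod n) then 1 else 0))"
  shows "sdp_feasible n Y"
    and "A \<in> carrier_mat n n \<Longrightarrow> B \<in> carrier_mat n n \<Longrightarrow>
      mat_inner (kron B A) Y = (\<Sum>i<n. \<Sum>j<n. A $$ (i, j) * B $$ (\<phi> i, \<phi> j))"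
proof -
  have Y: "Y \<in> carrier_mat (n * n) (n * n)" by (simp add: Y_def)
  have \<phi>n: "\<phi> i < n" if "i < n" for i using permutes_in_image[OF perm, of i] that by simp
  have \<phi>_inj: "\<phi> i = \<phi> j \<longleftrightarrow> i = j" for i j using permutes_inj[OF perm] by (auto dest: injD)
  have Y_index: "Y $$ (i * n + j, k * n + l) = (if i = \<phi> j then 1 else 0) * (if k = \<phi> l then 1 else 0)"
    if "i < n" "j < n" "k < n" "l < n" for i j k l
    using that by (simp add: Y_def outer_def pair_index_less)
  have inner: "mat_inner (kron M N) Y = (\<Sum>j<n. \<Sum>l<n. M $$ (\<phi> j, \<phi> l) * N $$ (j, l))"
    if M: "M \<in> carrier_mat n n" and N: "N \<in> carrier_mat n n" for M N
  proof -
    have "mat_inner (kron M N) Y = (\<Sum>i<n. \<Sum>j<n. \<Sum>k<n. \<Sum>l<n.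
        (if i = \<phi> j then 1 else 0) * ((if k = \<phi> l then 1 else 0) * (M $$ (i, k) * N $$ (j, l))))"
      unfolding mat_inner_kron[OF M N Y] by (intro sum.cong refl) (simp add: Y_index)
    also have "\<dots> = (\<Sum>j<n. \<Sum>i<n. \<Sum>k<n. \<Sum>l<n.
        (if i = \<phi> j then 1 else 0) * ((if k = \<phi> l then 1 else 0) * (M $$ (i, k) * N $$ (j, l))))"
      by (rule sum.swap)
    also have "\<dots> = (\<Sum>j<n. \<Sum>i<n. (if i = \<phi> j then 1 else 0) *
        (\<Sum>l<n. \<Sum>k<n. (if k = \<phi> l then 1 else 0) * (M $$ (i, k) * N $$ (j, l))))"
      unfolding sum_distrib_left by (rule sum.cong[OF refl], rule sum.cong[OF refl], rule sum.swap)
    also have "\<dots> = (\<Sum>j<n. \<Sum>l<n. M $$ (\<phi> j, \<phi> l) * N $$ (j, l))"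
      by (rule sum.cong[OF refl]) (simp add: sum_delta_mult \<phi>n)
    finally show ?thesis .
  qed
  show "mat_inner (kron B A) Y = (\<Sum>i<n. \<Sum>j<n. A $$ (i, j) * B $$ (\<phi> i, \<phi> j))"
    if "A \<in> carrier_mat n n" "B \<in> carrier_mat n n"
    using inner[OF that(2,1)] by (simp add: mult.commute)
  let ?J = "ones_mat n - 1\<^sub>m n"
  have J: "?J \<in> carrier_mat n n" by (intro minus_carrier_mat one_carrier_mat)
  have J_index: "?J $$ (i, j) = (if i = j then 0 else 1)" if "i < n" "j < n" for i j
    using that by (simp add: ones_mat_def)
  have one_index: "1\<^sub>m n $$ (\<phi> j, \<phi> l) = (if j = l then 1 else (0 :: real))" if "j < n" "l < n" for j l
    using that \<phi>n \<phi>_inj by simp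
  have c1: "mat_inner (kron (1\<^sub>m n) (unit_pos_mat n j j)) Y = 1" if j: "j < n" for j
  proof -
    have "mat_inner (kron (1\<^sub>m n) (unit_pos_mat n j j)) Y =
        (\<Sum>a<n. (if a = j then 1 else 0) * (\<Sum>l<n. (if l = j then 1 else 0) * (if a = l then 1 else 0)))"
      unfolding inner[OF one_carrier_mat unit_pos_mat_carrier] sum_distrib_left
      by (intro sum.cong refl) (simp add: one_index unit_pos_mat_def del: index_one_mat)
    thus ?thesis using j by (simp add: sum_delta_mult)
  qed
  have c2: "mat_inner (kron (unit_pos_mat n j j) (1\<^sub>m n)) Y = 1" if j: "j < n" for j
  proof -
    \<comment> \<open>The unit position \<open>j\<close> sits in the permuted factor, so it is met
      at the preimage of \<open>j\<close>.\<close>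
    define i where "i = inv_into UNIV \<phi> j"
    have i: "i < n" "\<phi> i = j"
      using permutes_in_image[OF permutes_inv[OF perm], of j] j permutes_inverses[OF perm] by (auto simp: i_def)
    have "mat_inner (kron (unit_pos_mat n j j) (1\<^sub>m n)) Y =
        (\<Sum>a<n. (if a = i then 1 else 0) * (\<Sum>l<n. (if l = i then 1 else 0) * (if a = l then 1 else 0)))"
      unfolding inner[OF unit_pos_mat_carrier one_carrier_mat] sum_distrib_left
      using i \<phi>_inj by (intro sum.cong refl) (auto simp: unit_pos_mat_def \<phi>n)
    thus ?thesis using i by (simp add: sum_delta_mult)
  qed
  have "mat_inner (kron (1\<^sub>m n) ?J) Y = 0"
    unfolding inner[OF one_carrier_mat J]
    by (intro sum.neutral ballI) (simp add: one_index J_index del: index_one_mat index_minus_mat)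
  moreover have "mat_inner (kron ?J (1\<^sub>m n)) Y = 0"
    unfolding inner[OF J one_carrier_mat]
    by (intro sum.neutral ballI) (simp add: \<phi>n J_index \<phi>_inj del: index_minus_mat)
  ultimately have c3: "mat_inner (kron (1\<^sub>m n) ?J + kron ?J (1\<^sub>m n)) Y = 0"
    by (simp add: mat_inner_add_left[OF kron_carrier[OF one_carrier_mat J] kron_carrier[OF J one_carrier_mat] Y])
  \<comment> \<open>Factoring the large all-ones matrix makes \<open>inner\<close> applicable to the
    constraint on the total.\<close>
  have "kron (ones_mat n) (ones_mat n) = ones_mat (n * n)"
    by (intro eq_mat_pairI[of _ n n n n] kron_carrier ones_mat_carrier)
      (simp_all add: kron_index[of _ n n _ n n] pair_index_less, simp add: ones_mat_def pair_index_less)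
  moreover have "mat_inner (kron (ones_mat n) (ones_mat n)) Y = (real n)\<^sup>2"
  proof -
    have "mat_inner (kron (ones_mat n) (ones_mat n)) Y = (\<Sum>j<n. \<Sum>l<n. 1)"
      unfolding inner[OF ones_mat_carrier ones_mat_carrier]
      by (intro sum.cong refl) (simp add: ones_mat_def \<phi>n)
    thus ?thesis by (simp add: power2_eq_square)
  qed
  ultimately have c4: "mat_inner (ones_mat (n * n)) Y = (real n)\<^sup>2" by simp
  have "0 \<le> Y $$ (p, q)" if "p < n * n" "q < n * n" for p q
    using that by (simp add: Y_def outer_def)
  moreover have "psd Y" unfolding Y_def by (intro psd_outer) simp
  ultimately show "sdp_feasible n Y"
    using Y c1 c2 c3 c4 by (simp add: sdp_feasible_def power2_eq_square)
qed

subsection \<open>The chain of inequalities\<close>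

theorem theorem2p3:
  fixes n :: nat and A B V S T :: "real mat"
  assumes "n > 0"
    and "A \<in> carrier_mat n n" and "symmetric_mat A"
    and "B \<in> carrier_mat n n" and "symmetric_mat B"
    and "onb_ones_complement n V"
    and "dual_optimal n V A B S T"
  shows "PB n V A B \<le> QPB n V A B S T
       \<and> QPB n V A B S T \<le> SDPQAP n A B
       \<and> SDPQAP n A B \<le> QAP n A B"
proof -
  note n = assms(1) and A = assms(2,3) and B = assms(4,5) and onb = assms(6)
  note V = onb_carrier[OF onb n]
  have dual: "dual_feasible n V A B (S, T)"
    and opt: "\<And>S' T'. dual_feasible n V A B (S', T') \<Longrightarrow> mat_trace (S' + T') \<le> mat_trace (S + T)"
    using assms(7) by (auto simp: dual_optimal_def is_arg_max_def not_less)
  have S: "S \<in> carrier_mat (n - 1) (n - 1)" and T: "T \<in> carrier_mat (n - 1) (n - 1)"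
    using dual by (auto simp: dual_feasible_def)

  obtain X where X: "doubly_stochastic n X"
    and X_min: "\<And>X'. doubly_stochastic n X' \<Longrightarrow> QPB_objective n V A B S T X \<le> QPB_objective n V A B S T X'"
    using doubly_stochastic_minimum_attained[OF continuous_on_QPB_objective[OF V A(1) B(1) S T]] by blast
  have QPB: "QPB n V A B S T = QPB_objective n V A B S T X"
    unfolding QPB_def by (rule Least_attained[where P = "doubly_stochastic n" and g = "QPB_objective n V A B S T", OF X X_min])

  have "{\<phi>. \<phi> permutes {..<n}} \<noteq> {}" using permutes_id by blast
  hence "QAP n A B \<in> (\<lambda>\<phi>. \<Sum>i<n. \<Sum>j<n. A $$ (i, j) * B $$ (\<phi> i, \<phi> j)) ` {\<phi>. \<phi> permutes {..<n}}"
    unfolding QAP_def using finite_permutations[of "{..<n}"] by (intro Min_in) auto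
  \<comment> \<open>An optimal permutation serves twice: its rank-one matrix shows that the
    semidefinite program is feasible, and it gives the last inequality of the chain.\<close>
  then obtain \<phi> where \<phi>: "\<phi> permutes {..<n}" "QAP n A B = (\<Sum>i<n. \<Sum>j<n. A $$ (i, j) * B $$ (\<phi> i, \<phi> j))"
    by auto
  note perm = permutation_sdp_feasible[OF \<phi>(1)]
  have BA: "kron B A \<in> carrier_mat (n * n) (n * n)" using A B by (intro kron_carrier)
  obtain Y where Y: "sdp_feasible n Y"
    and Y_min: "\<And>Y'. sdp_feasible n Y' \<Longrightarrow> mat_inner (kron B A) Y \<le> mat_inner (kron B A) Y'"
    using sdp_minimum_attained[OF BA] perm(1) by blast
  have SDP: "SDPQAP n A B = mat_inner (kron B A) Y"
    unfolding SDPQAP_def by (rule Least_attained[where P = "sdp_feasible n" and g = "mat_inner (kron B A)", OF Y Y_min])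

  have compress_sym: "symmetric_mat (compress V M)" if "M \<in> carrier_mat n n" "symmetric_mat M" for M
    using symmetric_mat_congruence[of "V\<^sup>T" "n - 1" n M] V that by (simp add: compress_def)
  obtain S' T' where ST': "S' \<in> carrier_mat (n - 1) (n - 1)" "symmetric_mat S'"
    "T' \<in> carrier_mat (n - 1) (n - 1)" "symmetric_mat T'"
    "psd (kron (compress V B) (compress V A) - kron (1\<^sub>m (n - 1)) S' - kron T' (1\<^sub>m (n - 1)))"
    "min_inner (eigenvalues (compress V A)) (eigenvalues (compress V B)) \<le> mat_trace (S' + T')"
    by (rule dual_feasible_attaining_min_inner[OF compress_carrier[OF V A(1)] compress_sym[OF A]
      compress_carrier[OF V B(1)] compress_sym[OF B]])
  hence "dual_feasible n V A B (S', T')" by (simp add: dual_feasible_def Q_hat_def)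
  \<comment> \<open>Optimality of \<open>S\<close>, \<open>T\<close> against the constructed dual
    point gives the sign needed to drop the two extra terms in
    \<open>QPB_objective_le_sdp\<close>.\<close>
  hence trace: "min_inner (eigenvalues (compress V A)) (eigenvalues (compress V B)) \<le> mat_trace (S + T)"
    using opt ST'(6) by fastforce

  have "PB n V A B \<le> QPB n V A B S T"
    unfolding QPB by (rule PB_le_QPB_objective[OF n A B V dual X])
  moreover have "QPB n V A B S T \<le> SDPQAP n A B"
    unfolding QPB SDP
    using X_min[OF diagonal_of_sdp_feasible(1)[OF Y n]] QPB_objective_le_sdp[OF n A B onb dual Y] trace
    by linarith
  moreover have "SDPQAP n A B \<le> QAP n A B"
    unfolding SDP \<phi>(2) using Y_min[OF perm(1)] perm(2)[OF A(1) B(1)] by simp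
  ultimately show ?thesis by blast
qed

end
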